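(* Let $X$ be a separable Banach space and let $f:X\to\mathbb{R}$ be quasiconvex and densely continuous. If $\mathcal{T}\operatorname{ess\,inf}_X f=-\infty$, then $f$ is Hadamard differentiable on $X$ except at the points of an Aronszajn null set.
   Context: Banach spaces are real. A function $f:X\to\mathbb{R}$ is quasiconvex if $f(\lambda x+(1-\lambda)y)\le\max\{f(x),f(y)\}$ for all $x,y\in X$ and $\lambda\in[0,1]$. It is densely continuous if it is continuous at the points of a dense subset of $X$. For $\alpha\in\mathbb{R}$, $F_\alpha:=\{x\in X:f(x)<\alpha\}$. First category means a countable union of nowhere dense subsets of $X$; second category means not of first category. The topological essential infimum is $\mathcal{T}\operatorname{ess\,inf}_X f:=\sup\{\alpha\in\mathbb{R}:F_\alpha\text{ is of first category}\}=\inf\{\alpha\in\mathbb{R}:F_\alpha\text{ is of second category}\}\in[-\infty,\infty)$ (with $\sup\emptyset=-\infty$). $f$ is Gâteaux differentiable at $x$ with derivative $Df(x)\in X^*$ if $Df(x)h=\lim_{t\to0}\frac{f(x+th)-f(x)}{t}$ for every $h\in X$; it is Hadamard differentiable at $x$ if moreover the limit is uniform for $h$ in every compact subset of $X$. A Borel set $E\subset X$ is Aronszajn null if for every sequence $(\xi_n)\subset X$ with $\overline{\operatorname{span}}\{\xi_n\}=X$ one can write $E=\bigcup_nE_n$ with $E_n$ Borel and, for every $x\in X$, $\lambda_1((x+\mathbb{R}\xi_n)\cap E_n)=0$ ($\lambda_1$ = one-dimensional Lebesgue measure). "A property holds on $S$ except at the points of an Aronszajn null set" means that there is an Aronszajn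 null set $N$ such that the property holds at every point of $S\setminus N$. *)

theory Defs
  imports "HOL-Analysis.Analysis"
begin

definition quasiconvex :: "('a::real_vector \<Rightarrow> real) \<Rightarrow> bool"
  where "quasiconvex f \<longleftrightarrow>
    (\<forall>x y. \<forall>l\<in>{0..1}. f (l *\<^sub>R x + (1 - l) *\<^sub>R y) \<le> max (f x) (f y))"

definition densely_continuous :: "('a::t2_space \<Rightarrow> 'b::topological_space) \<Rightarrow> bool"
  where "densely_continuous f \<longleftrightarrow> (\<exists>D. closure D = UNIV \<and> (\<forall>x\<in>D. isCont f x))"

definition nowhere_dense :: "'a::topological_space set \<Rightarrow> bool"
  where "nowhere_dense S \<longleftrightarrow> interior (closure S) = {}"

definition first_category :: "'a::topological_space set \<Rightarrow> bool"
  where "first_category S \<longleftrightarrow>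
    (\<exists>\<N>. countable \<N> \<and> (\<forall>N\<in>\<N>. nowhere_dense N) \<and> S = \<Union>\<N>)"

definition top_ess_inf :: "('a::topological_space \<Rightarrow> real) \<Rightarrow> ereal"
  where "top_ess_inf f = Sup {ereal \<alpha> |\<alpha>. first_category {x. f x < \<alpha>}}"

definition has_gateaux_derivative ::
    "('a::real_normed_vector \<Rightarrow> real) \<Rightarrow> ('a \<Rightarrow>\<^sub>L real) \<Rightarrow> 'a \<Rightarrow> bool"
  where "has_gateaux_derivative f D x \<longleftrightarrow>
    (\<forall>h. ((\<lambda>t. (f (x + t *\<^sub>R h) - f x) / t) \<longlongrightarrow> blinfun_apply D h) (at 0))"

definition hadamard_differentiable_at ::
    "('a::real_normed_vector \<Rightarrow> real) \<Rightarrow> 'a \<Rightarrow> bool"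
  where "hadamard_differentiable_at f x \<longleftrightarrow>
    (\<exists>D. has_gateaux_derivative f D x \<and>
      (\<forall>K. compact K \<longrightarrow>
        uniform_limit K (\<lambda>t h. (f (x + t *\<^sub>R h) - f x) / t) (blinfun_apply D) (at 0)))"

text \<open>
  The Lebesgue measure of the part of \<open>E n\<close> on the line \<open>x + \<real> \<xi> n\<close> is expressed through the
  parametrisation \<open>t \<mapsto> x + t \<xi> n\<close>, which for \<open>\<xi> n \<noteq> 0\<close> only changes the measure by the
  factor \<open>norm (\<xi> n)\<close>.  If \<open>\<xi> n = 0\<close> the condition forces \<open>E n = {}\<close>; in a nontrivial space this
  gives the same null sets as admitting only sequences of nonzero vectors.
\<close>

definition aronszajn_null :: "'a::real_normed_vector set \<Rightarrow> bool"
  where "aronszajn_null A \<longleftrightarrow>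
    A \<in> sets borel \<and>
    (\<forall>\<xi> :: nat \<Rightarrow> 'a. closure (span (range \<xi>)) = UNIV \<longrightarrow>
      (\<exists>E :: nat \<Rightarrow> 'a set.
        (\<forall>n. E n \<in> sets borel) \<and> A = (\<Union>n. E n) \<and>
        (\<forall>n x. {t. x + t *\<^sub>R \<xi> n \<in> E n} \<in> null_sets lborel)))"

lemma first_category_subset:
  assumes "first_category T" "S \<subseteq> T"
  shows "first_category S"
proof -
  obtain \<N> where N: "countable \<N>" "\<forall>N\<in>\<N>. nowhere_dense N" "T = \<Union>\<N>"
    using assms(1) unfolding first_category_def by blast
  have "nowhere_dense (S \<inter> N)" if "N \<in> \<N>" for N
  proof -
    have "interior (closure (S \<inter> N)) \<subseteq> interior (closure N)"
      by (intro interior_mono closure_mono) simp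
    with N(2) that show ?thesis
      unfolding nowhere_dense_def by auto
  qed
  moreover have "S = \<Union>((\<lambda>N. S \<inter> N) ` \<N>)"
    using N(3) assms(2) by blast
  ultimately show ?thesis
    unfolding first_category_def using N(1)
    by (intro exI[of _ "(\<lambda>N. S \<inter> N) ` \<N>"] conjI countable_image) simp_all
qed

lemma top_ess_inf_eq_Inf:
  "top_ess_inf f = Inf {ereal \<alpha> |\<alpha>. \<not> first_category {x. f x < \<alpha>}}"
proof (rule antisym)
  have "\<alpha> \<le> \<beta>"
    if "first_category {x. f x < \<alpha>}" "\<not> first_category {x. f x < \<beta>}" for \<alpha> \<beta>
  proof (rule ccontr)
    assume "\<not> \<alpha> \<le> \<beta>"
    then have "{x. f x < \<beta>} \<subseteq> {x. f x < \<alpha>}" by auto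
    with that show False using first_category_subset by blast
  qed
  then show "top_ess_inf f \<le> Inf {ereal \<alpha> |\<alpha>. \<not> first_category {x. f x < \<alpha>}}"
    unfolding top_ess_inf_def
    by (intro Sup_least Inf_greatest) (clarsimp simp del: not_le)
next
  show "Inf {ereal \<alpha> |\<alpha>. \<not> first_category {x. f x < \<alpha>}} \<le> top_ess_inf f"
  proof (rule ccontr)
    assume "\<not> ?thesis"
    then have "top_ess_inf f < Inf {ereal \<alpha> |\<alpha>. \<not> first_category {x. f x < \<alpha>}}"
      by (simp only: not_le)
    from ereal_dense2[OF this] obtain r where r: "top_ess_inf f < ereal r"
      "ereal r < Inf {ereal \<alpha> |\<alpha>. \<not> first_category {x. f x < \<alpha>}}"
      by blast
    show False
    proof (cases "first_category {x. f x < r}")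
      case True
      then have "ereal r \<le> top_ess_inf f"
        unfolding top_ess_inf_def by (intro Sup_upper) blast
      with r(1) show False by simp
    next
      case False
      then have "Inf {ereal \<alpha> |\<alpha>. \<not> first_category {x. f x < \<alpha>}} \<le> ereal r"
        by (intro Inf_lower) blast
      with r(2) show False by simp
    qed
  qed
qed

end

theory Submission
  imports Defs
begin

text \<open>
  A quasiconvex function on the real line decreases and then increases, so by Lebesgue's theorem on
  monotone functions (\<open>mono_differentiable_ae\<close>) it is differentiable almost everywhere. Hence \<open>f\<close> is
  differentiable almost everywhere on every line, and the exceptional sets are null in the sense
  that the decomposition of an Aronszajn null set requires. The problem is to pass from derivatives on
  lines to a Hadamard derivative, leaving out only sets decomposable along an arbitrary given sequence
  \<open>\<xi>\<close> with dense span, and to do so with Borel sets although \<open>f\<close> need not be Borel measurable.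

  The tool is porosity (\<open>null_cover_porous\<close>): for any set \<open>A\<close> and any direction \<open>u\<close>, the points of \<open>A\<close>
  at which \<open>A\<close> is porous in direction \<open>u\<close> can be left out. If \<open>u\<close> is a multiple of some \<open>\<xi> n\<close>, then these are
  points where the distance to \<open>A\<close> is not differentiable along \<open>\<xi> n\<close>, and adding a linear function to
  this distance makes it monotone. Sums of directions are treated by nesting, limits by approximation.
  So for almost every point \<open>x\<close> of \<open>A\<close>, a small step from \<open>x\<close> in a given direction ends near points of \<open>A\<close>,
  at a distance small compared with the step.

  Since the essential infimum is \<open>-\<infinity>\<close> and \<open>f\<close> is densely continuous, every sublevel set contains a ball
  (\<open>sublevel_contains_ball\<close>), so that \<open>g = max f (-k)\<close> is minimal on a ball. By quasiconvexity, \<open>g\<close> is then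
  locally monotone with respect to an open cone that contains a combination \<open>e\<close> of the \<open>\<xi> n\<close>. At a point where
  \<open>g\<close> is Lipschitz along the lines occurring in \<open>e\<close>, quasiconvexity carries the upper bounds from the lines to
  \<open>x + \<tau> e\<close>, and monotonicity from there to a neighbourhood (\<open>upper_points_cover\<close>). The lower bound follows
  from the upper bound at a nearby point below \<open>x\<close>, which exists by porosity
  (\<open>lipschitz_if_upper_not_porous\<close>). So \<open>g\<close> is Lipschitz at almost every point.

  At almost every point \<open>x\<close> where \<open>g\<close> is Lipschitz with constant \<open>m\<close>, porosity provides further such points
  close to all points \<open>x + t v\<close>; therefore the derivative of \<open>g\<close> along a line describes \<open>g\<close> also near the
  line (\<open>line_derivative_imp_direction_derivative\<close>). In the same way one sees that derivatives in two
  directions add up (\<open>approx_points_add\<close>): go from \<open>x\<close> in direction \<open>u\<close>, and then in direction \<open>v\<close> from a point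
  near \<open>x + t u\<close> at which the same estimates hold. This gives derivatives along a dense set of directions, hence
  along all of them with uniformity on compact sets (\<open>robust_derivativeI\<close>, \<open>robust_derivative_hadamard\<close>).
  The set of points with such a derivative is Borel and does not depend on \<open>\<xi>\<close>; its complement is the
  exceptional set for \<open>g\<close>. Finally, \<open>f\<close> agrees with \<open>g\<close> near every point of continuity of \<open>g\<close> where \<open>f > -k\<close>.
\<close>

section \<open>Differentiability of monotone and quasiconvex functions of one variable\<close>

lemma disjnt_cballs_ordered:
  fixes a b :: real
  assumes "disjnt (cball a r) (cball b s)" "a \<le> b" "0 < r" "0 < s"
  shows "a + r < b - s"
proof (rule ccontr)
  assume "\<not> ?thesis"
  then have "max a (b - s) \<in> cball a r \<and> max a (b - s) \<in> cball b s"
    using assms(2-4) by (auto simp: cball_eq_atLeastAtMost max_def)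
  then show False using assms(1) by (auto simp: disjnt_def)
qed

text \<open>Peel off the rightmost interval: all the others lie to the left of it.\<close>

lemma sum_increments_le:
  fixes \<phi> :: "real \<Rightarrow> real"
  assumes "mono \<phi>" "finite F"
    and "\<And>i. i \<in> F \<Longrightarrow> 0 < snd i \<and> cball (fst i) (snd i) \<subseteq> {u..v}"
    and "pairwise (\<lambda>i j. disjnt (cball (fst i) (snd i)) (cball (fst j) (snd j))) F"
    and "u \<le> v"
  shows "(\<Sum>i\<in>F. \<phi> (fst i + snd i) - \<phi> (fst i - snd i)) \<le> \<phi> v - \<phi> u"
  using assms(2-5)
proof (induction arbitrary: v rule: finite_ranking_induct[where f = fst])
  case empty
  then show ?case using monoD[OF assms(1)] by simp
next
  case (insert x S)
  show ?case
  proof (cases "x \<in> S")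
    case True
    then show ?thesis using insert by (simp add: insert_absorb)
  next
    case False
    have x: "0 < snd x" "u \<le> fst x - snd x" "fst x + snd x \<le> v"
      using insert.prems(1)[of x] by (auto simp: cball_eq_atLeastAtMost)
    have "(\<Sum>i\<in>S. \<phi> (fst i + snd i) - \<phi> (fst i - snd i)) \<le> \<phi> (fst x - snd x) - \<phi> u"
    proof (rule insert.IH)
      fix i assume i: "i \<in> S"
      have "disjnt (cball (fst i) (snd i)) (cball (fst x) (snd x))"
        using insert.prems(2) i False by (auto simp: pairwise_def)
      moreover have "fst i \<le> fst x" using insert.hyps i by blast
      moreover have "0 < snd i" using insert.prems(1) i by auto
      ultimately show "0 < snd i \<and> cball (fst i) (snd i) \<subseteq> {u..fst x - snd x}"
        using x(1) insert.prems(1)[of i] i disjnt_cballs_ordered[of "fst i" "snd i" "fst x" "snd x"]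
        by (auto simp: cball_eq_atLeastAtMost)
    qed (use insert.prems x in \<open>auto simp: pairwise_insert\<close>)
    moreover have "\<phi> (fst x + snd x) \<le> \<phi> v"
      using monoD[OF assms(1) x(3)] .
    ultimately show ?thesis using insert.hyps False by simp
  qed
qed

text \<open>The countable disjoint family of the Vitali covering theorem has finite total length, so finitely
  many of its members already cover \<open>E\<close> up to a set of small measure. Finite families suffice below
  and keep all sums of increments finite.\<close>

lemma vitali_finite:
  fixes E V :: "real set"
  assumes "E \<subseteq> V" "open V" "V \<in> lmeasurable" "0 < \<epsilon>"
    and K: "\<And>x d. \<lbrakk>x \<in> E; 0 < d\<rbrakk> \<Longrightarrow> \<exists>i\<in>K. 0 < snd i \<and> snd i < d \<and> x \<in> cball (fst i) (snd i)"
  obtains F R where "finite F" "F \<subseteq> K"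
    "\<And>i. i \<in> F \<Longrightarrow> 0 < snd i \<and> cball (fst i) (snd i) \<subseteq> V"
    "pairwise (\<lambda>i j. disjnt (cball (fst i) (snd i)) (cball (fst j) (snd j))) F"
    "R \<in> lmeasurable" "measure lebesgue R < \<epsilon>"
    "E \<subseteq> (\<Union>i\<in>F. ball (fst i) (snd i)) \<union> R"
proof -
  define B :: "real \<times> real \<Rightarrow> real set" where "B = (\<lambda>i. cball (fst i) (snd i))"
  define K' where "K' = {i\<in>K. 0 < snd i \<and> B i \<subseteq> V}"
  have "\<exists>i. i \<in> K' \<and> x \<in> cball (fst i) (snd i) \<and> snd i < d" if xE: "x \<in> E" and d: "0 < d" for x d
  proof -
    obtain e where e: "0 < e" "ball x e \<subseteq> V"
      using assms(1,2) \<open>x \<in> E\<close> by (meson open_contains_ball subsetD)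
    obtain i where i: "i \<in> K" "0 < snd i" "snd i < min d (e / 2)" "x \<in> B i"
      using K[OF \<open>x \<in> E\<close>, of "min d (e/2)"] d e(1) unfolding B_def by (metis half_gt_zero min_less_iff_conj)
    have "B i \<subseteq> ball x e"
      using i(3,4) unfolding B_def by (auto simp: dist_real_def)
    then show ?thesis using i e(2) unfolding K'_def B_def by (intro exI[of _ i]) auto
  qed
  note cover = this
  obtain C where C: "countable C" "C \<subseteq> K'"
    "pairwise (\<lambda>i j. disjnt (B i) (B j)) C" "negligible (E - (\<Union>i\<in>C. B i))"
  proof (rule Vitali_covering_theorem_cballs[of K' snd E fst])
    show "0 < snd i" if "i \<in> K'" for i using that by (simp add: K'_def)
  next
    fix x d :: real assume "x \<in> E" "0 < d"
    then show "\<exists>i. i \<in> K' \<and> x \<in> cball (fst i) (snd i) \<and> snd i < d" by (rule cover)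
  next
    fix C assume "countable C" "C \<subseteq> K'"
      "pairwise (\<lambda>i j. disjnt (cball (fst i) (snd i)) (cball (fst j) (snd j))) C"
      "negligible (E - (\<Union>i\<in>C. cball (fst i) (snd i)))"
    then show thesis by (intro that[of C]) (simp_all add: B_def)
  qed
  have Bm: "B i \<in> lmeasurable" for i unfolding B_def by simp
  have CV: "(\<Union>i\<in>C. B i) \<subseteq> V" using C(2) unfolding K'_def by auto
  obtain F' where F': "F' \<subseteq> B ` C" "finite F'" "measure lebesgue (\<Union>(B ` C)) - \<epsilon> < measure lebesgue (\<Union>F')"
  proof (rule measure_countable_Union_approachable[of "B ` C" \<epsilon> "measure lebesgue V"])
    fix D' assume "D' \<subseteq> B ` C" "finite D'"
    then have "\<Union>D' \<in> lmeasurable" "\<Union>D' \<subseteq> V"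
      using CV Bm by (blast intro: fmeasurable.finite_Union)+
    then show "measure lebesgue (\<Union>D') \<le> measure lebesgue V"
      using assms(3) by (intro measure_mono_fmeasurable fmeasurableD)
  qed (use C(1) Bm assms(4) in auto)
  obtain F where F: "finite F" "F \<subseteq> C" "F' = B ` F"
    using finite_subset_image[OF F'(2,1)] by auto
  have CM: "(\<Union>i\<in>C. B i) \<in> lmeasurable"
    using CV assms(3) C(1) Bm by (intro fmeasurableI2[OF assms(3)] sets.countable_UN') auto
  have FM: "(\<Union>i\<in>F. B i) \<in> lmeasurable" using F(1) Bm by auto
  \<comment> \<open>The end points of the chosen intervals form a finite set and go into the remainder.\<close>
  let ?S = "\<Union>i\<in>F. sphere (fst i) (snd i)"
  define R where "R = ((\<Union>i\<in>C. B i) - (\<Union>i\<in>F. B i)) \<union> ((E - (\<Union>i\<in>C. B i)) \<union> ?S)"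
  have "negligible ?S"
    using F(1) by (intro negligible_Union) (auto simp: negligible_sphere)
  with C(4) have N: "negligible ((E - (\<Union>i\<in>C. B i)) \<union> ?S)"
    by (rule negligible_Un)
  have dM: "(\<Union>i\<in>C. B i) - (\<Union>i\<in>F. B i) \<in> lmeasurable"
    using CM FM by (rule fmeasurable.Diff)
  have "measure lebesgue R \<le> measure lebesgue ((\<Union>i\<in>C. B i) - (\<Union>i\<in>F. B i)) + 0"
    unfolding R_def negligible_imp_measure0[OF N, symmetric]
    by (intro measure_Un_le fmeasurableD dM negligible_imp_measurable N)
  also have "\<dots> = measure lebesgue (\<Union>i\<in>C. B i) - measure lebesgue (\<Union>i\<in>F. B i)"
    using measurable_measure_Diff[OF CM fmeasurableD[OF FM]] F(2) by auto
  finally have "measure lebesgue R < \<epsilon>" using F'(3) F(3) by simp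
  moreover have "R \<in> lmeasurable"
    unfolding R_def using dM negligible_imp_measurable[OF N] by (rule fmeasurable.Un)
  moreover have "E \<subseteq> (\<Union>i\<in>F. ball (fst i) (snd i)) \<union> R"
  proof
    fix x assume "x \<in> E"
    have "B i = ball (fst i) (snd i) \<union> sphere (fst i) (snd i)" for i
      unfolding B_def by auto
    with \<open>x \<in> E\<close> show "x \<in> (\<Union>i\<in>F. ball (fst i) (snd i)) \<union> R"
      unfolding R_def by blast
  qed
  moreover have "pairwise (\<lambda>i j. disjnt (cball (fst i) (snd i)) (cball (fst j) (snd j))) F"
    using C(3) F(2) unfolding B_def by (rule pairwise_subset)
  ultimately show thesis
    using that[of F R] F(1,2) C(2) unfolding K'_def B_def by auto
qed

definition increment :: "(real \<Rightarrow> real) \<Rightarrow> real \<times> real \<Rightarrow> real"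
  where "increment \<phi> i = \<phi> (fst i + snd i) - \<phi> (fst i - snd i)"

text \<open>Near every point of \<open>E\<close> the increments of \<open>\<phi>\<close> over some arbitrarily small intervals are at least
  \<open>q\<close> times the length. Choosing such intervals disjoint and inside the members of \<open>F\<close>, their total
  length is at most \<open>1 / q\<close> times the total increment of \<open>\<phi>\<close> over \<open>F\<close>, by monotonicity.\<close>

lemma steep_points_cover:
  fixes \<phi> :: "real \<Rightarrow> real"
  assumes "mono \<phi>" "finite F" "\<And>i. i \<in> F \<Longrightarrow> 0 < snd i"
    and "pairwise (\<lambda>i j. disjnt (cball (fst i) (snd i)) (cball (fst j) (snd j))) F"
    and "E \<subseteq> (\<Union>i\<in>F. ball (fst i) (snd i))" "0 < q" "0 < \<epsilon>"
    and steep: "\<And>x d. \<lbrakk>x \<in> E; 0 < d\<rbrakk> \<Longrightarrow>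
      \<exists>i. 0 < snd i \<and> snd i < d \<and> x \<in> cball (fst i) (snd i) \<and> q * (2 * snd i) \<le> increment \<phi> i"
  obtains T where "T \<in> lmeasurable" "E \<subseteq> T"
    "q * measure lebesgue T \<le> (\<Sum>i\<in>F. increment \<phi> i) + q * \<epsilon>"
proof -
  define V where "V = (\<Union>i\<in>F. ball (fst i) (snd i))"
  define K where "K = {k. q * (2 * snd k) \<le> increment \<phi> k \<and> (\<exists>i\<in>F. cball (fst k) (snd k) \<subseteq> ball (fst i) (snd i))}"
  have V: "open V" "V \<in> lmeasurable" "E \<subseteq> V"
    using assms(2,5) unfolding V_def by auto
  have "\<exists>k\<in>K. 0 < snd k \<and> snd k < d \<and> x \<in> cball (fst k) (snd k)" if xE: "x \<in> E" and d: "0 < d" for x d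
  proof -
    obtain i where i: "i \<in> F" "x \<in> ball (fst i) (snd i)" using assms(5) xE by auto
    obtain e where e: "0 < e" "ball x e \<subseteq> ball (fst i) (snd i)"
      using i(2) by (meson open_ball open_contains_ball)
    obtain k where k: "0 < snd k" "snd k < min d (e / 2)" "x \<in> cball (fst k) (snd k)" "q * (2 * snd k) \<le> increment \<phi> k"
      using steep[OF xE, of "min d (e/2)"] d e(1) by auto
    have "cball (fst k) (snd k) \<subseteq> ball x e"
      using k(2,3) by (auto simp: dist_real_def)
    then show ?thesis using k i e(2) unfolding K_def by (intro bexI[of _ k]) auto
  qed
  note cover = this
  obtain G R where G: "finite G" "G \<subseteq> K"
    "\<And>i. i \<in> G \<Longrightarrow> 0 < snd i \<and> cball (fst i) (snd i) \<subseteq> V"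
    "pairwise (\<lambda>i j. disjnt (cball (fst i) (snd i)) (cball (fst j) (snd j))) G"
    and R: "R \<in> lmeasurable" "measure lebesgue R < \<epsilon>"
    "E \<subseteq> (\<Union>i\<in>G. ball (fst i) (snd i)) \<union> R"
    by (rule vitali_finite[OF V(3,1,2) \<open>0 < \<epsilon>\<close>, of K]) (use cover in \<open>assumption | blast\<close>)+
  define T where "T = (\<Union>i\<in>G. ball (fst i) (snd i)) \<union> R"
  have "\<forall>k\<in>G. \<exists>i. i \<in> F \<and> cball (fst k) (snd k) \<subseteq> ball (fst i) (snd i)"
    using G(2) unfolding K_def by blast
  then obtain p where p: "\<And>k. k \<in> G \<Longrightarrow> p k \<in> F \<and> cball (fst k) (snd k) \<subseteq> ball (fst (p k)) (snd (p k))"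
    by metis
  have "measure lebesgue T \<le> measure lebesgue (\<Union>i\<in>G. ball (fst i) (snd i)) + measure lebesgue R"
    unfolding T_def using G(1) R(1) by (intro measure_Un_le) auto
  also have "\<dots> \<le> (\<Sum>i\<in>G. measure lebesgue (ball (fst i) (snd i))) + \<epsilon>"
    using G(1) R(2) by (intro add_mono measure_UNION_le) auto
  also have "(\<Sum>i\<in>G. measure lebesgue (ball (fst i) (snd i))) = (\<Sum>i\<in>G. 2 * snd i)"
    using G(3) by (intro sum.cong refl) (simp add: ball_eq_greaterThanLessThan less_imp_le)
  finally have "q * measure lebesgue T \<le> q * ((\<Sum>i\<in>G. 2 * snd i) + \<epsilon>)"
    using \<open>0 < q\<close> by simp
  also have "\<dots> = (\<Sum>i\<in>G. q * (2 * snd i)) + q * \<epsilon>"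
    by (simp add: sum_distrib_left distrib_left)
  also have "(\<Sum>i\<in>G. q * (2 * snd i)) \<le> (\<Sum>k\<in>G. increment \<phi> k)"
    using G(2) unfolding K_def by (intro sum_mono) auto
  also have "(\<Sum>k\<in>G. increment \<phi> k) = (\<Sum>i\<in>F. \<Sum>k\<in>{k\<in>G. p k = i}. increment \<phi> k)"
    using p by (intro sum.group[symmetric] G(1) assms(2)) auto
  also have "\<dots> \<le> (\<Sum>i\<in>F. increment \<phi> i)"
  proof (rule sum_mono)
    fix i assume "i \<in> F"
    show "(\<Sum>k\<in>{k\<in>G. p k = i}. increment \<phi> k) \<le> increment \<phi> i"
      unfolding increment_def
    proof (rule sum_increments_le[OF assms(1)])
      fix k assume "k \<in> {k \<in> G. p k = i}"
      then show "0 < snd k \<and> cball (fst k) (snd k) \<subseteq> {fst i - snd i..fst i + snd i}"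
        using p[of k] G(3)[of k] ball_subset_cball[of "fst i" "snd i"]
        unfolding cball_eq_atLeastAtMost[symmetric] by blast
    qed (use G(1,4) assms(3)[OF \<open>i \<in> F\<close>] in \<open>auto intro: pairwise_subset\<close>)
  qed
  finally have "q * measure lebesgue T \<le> (\<Sum>i\<in>F. increment \<phi> i) + q * \<epsilon>" by simp
  moreover have "T \<in> lmeasurable"
    unfolding T_def using G(1) R(1) by (intro fmeasurable.Un fmeasurable.finite_UN) auto
  ultimately show thesis using that[of T] R(3) unfolding T_def by blast
qed

text \<open>The limit is the infimum of the eventual upper bounds: if \<open>Q\<close> were frequently below \<open>L - e\<close>, then
  it would eventually stay below a number smaller than \<open>L\<close>.\<close>

lemma tendsto_if_no_oscillation:
  fixes Q :: "'a \<Rightarrow> real"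
  assumes "F \<noteq> bot" "\<forall>\<^sub>F x in F. \<bar>Q x\<bar> \<le> M"
    and osc: "\<And>p q. \<lbrakk>p \<in> \<rat>; q \<in> \<rat>; p < q; \<exists>\<^sub>F x in F. Q x < p\<rbrakk> \<Longrightarrow> \<forall>\<^sub>F x in F. Q x \<le> q"
  shows "\<exists>L. (Q \<longlongrightarrow> L) F"
proof -
  define S where "S = {q. \<forall>\<^sub>F x in F. Q x \<le> q}"
  define L where "L = Inf S"
  have "M \<in> S" using assms(2) unfolding S_def by (auto elim: eventually_mono)
  have lower: "- M \<le> q" if "q \<in> S" for q
  proof -
    have "\<forall>\<^sub>F x in F. - M \<le> q"
      using assms(2) that[unfolded S_def mem_Collect_eq] by eventually_elim auto
    then show ?thesis using assms(1) by (simp add: eventually_const_iff)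
  qed
  then have bdd: "bdd_below S" by (intro bdd_belowI)
  have "\<forall>\<^sub>F x in F. dist (Q x) L < e" if "0 < e" for e
  proof -
    obtain q where "q \<in> S" "q < L + e"
      using cInf_lessD[of S "L + e"] \<open>M \<in> S\<close> \<open>0 < e\<close> unfolding L_def by fastforce
    then have up: "\<forall>\<^sub>F x in F. Q x < L + e"
      unfolding S_def by (auto elim: eventually_mono)
    \<comment> \<open>Two rationals between \<open>L - e\<close> and \<open>L\<close>: the second one is not an eventual upper bound.\<close>
    obtain p where p: "p \<in> \<rat>" "L - e < p" "p < L" using Rats_dense_in_real[of "L - e" L] \<open>0 < e\<close> by auto
    obtain p' where p': "p' \<in> \<rat>" "p < p'" "p' < L" using Rats_dense_in_real[OF p(3)] by auto
    have "p' \<notin> S" using cInf_lower[OF _ bdd, of p'] p'(3) unfolding L_def by auto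
    then have "\<not> (\<exists>\<^sub>F x in F. Q x < p)"
      using osc[OF p(1) p'(1,2)] unfolding S_def by auto
    then have "\<forall>\<^sub>F x in F. p \<le> Q x" by (simp add: not_frequently not_less)
    with up show ?thesis
      by eventually_elim (use p(2) in \<open>auto simp: dist_real_def\<close>)
  qed
  then show ?thesis by (auto simp: tendsto_iff)
qed

definition difference_quotient :: "(real \<Rightarrow> real) \<Rightarrow> real \<Rightarrow> real \<Rightarrow> real"
  where "difference_quotient \<phi> x h = (\<phi> (x + h) - \<phi> x) / h"

lemma interval_of_difference_quotient:
  fixes \<phi> :: "real \<Rightarrow> real"
  assumes "\<exists>\<^sub>F h in at 0. P (difference_quotient \<phi> x h)" "0 < d"
  shows "\<exists>i. 0 < snd i \<and> snd i < d \<and> x \<in> cball (fst i) (snd i) \<and> P (increment \<phi> i / (2 * snd i))"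
proof -
  have "\<forall>\<^sub>F h in at (0::real). h \<noteq> 0 \<and> \<bar>h\<bar> < d"
    using assms(2) unfolding eventually_at by (auto simp: dist_real_def)
  with assms(1) have "\<exists>\<^sub>F h in at 0. P (difference_quotient \<phi> x h) \<and> h \<noteq> 0 \<and> \<bar>h\<bar> < d"
    by (rule frequently_eventually_frequently)
  then obtain h where h: "P (difference_quotient \<phi> x h)" "h \<noteq> 0" "\<bar>h\<bar> < d"
    by (auto dest: frequently_ex)
  have "increment \<phi> (x + h / 2, \<bar>h\<bar> / 2) / \<bar>h\<bar> = difference_quotient \<phi> x h"
  proof (cases "0 < h")
    case True
    then have "x + h / 2 + \<bar>h\<bar> / 2 = x + h" "x + h / 2 - \<bar>h\<bar> / 2 = x" by (simp_all add: field_simps)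
    with True show ?thesis by (simp only: increment_def difference_quotient_def fst_conv snd_conv abs_of_pos)
  next
    case False
    then have "x + h / 2 + \<bar>h\<bar> / 2 = x" "x + h / 2 - \<bar>h\<bar> / 2 = x + h" by (simp_all add: field_simps)
    then show ?thesis using False h(2)
      by (simp only: increment_def difference_quotient_def fst_conv snd_conv) (simp add: minus_divide_left[symmetric] field_simps)
  qed
  then show ?thesis using h by (intro exI[of _ "(x + h / 2, \<bar>h\<bar> / 2)"]) (auto simp: dist_real_def)
qed

text \<open>Covering by intervals of slope at least \<open>n\<close> bounds the measure by the total increment over
  \<open>n\<close>, for every \<open>n\<close>.\<close>

lemma negligible_infinite_slope:
  assumes "mono \<phi>"
  shows "negligible {x \<in> {-b<..<b}. \<forall>n::nat. \<exists>\<^sub>F h in at 0. real n < difference_quotient \<phi> x h}"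
    (is "negligible ?E")
proof (cases "0 < b")
  case True
  show ?thesis
    unfolding negligible_outer_le
  proof (intro allI impI)
    fix e :: real assume e: "0 < e"
    define D where "D = increment \<phi> (0, b)"
    have "0 \<le> D" using monoD[OF assms, of "-b" b] True by (simp add: D_def increment_def)
    obtain n :: nat where n: "2 * D / e < n" using reals_Archimedean2 by blast
    then have n0: "0 < real n" using \<open>0 \<le> D\<close> e by (smt (verit) divide_nonneg_pos)
    obtain T where T: "T \<in> lmeasurable" "?E \<subseteq> T"
      "real n * measure lebesgue T \<le> (\<Sum>i\<in>{(0, b)}. increment \<phi> i) + real n * (e / 2)"
    proof (rule steep_points_cover[OF assms, of "{(0, b)}" ?E "real n" "e / 2"])
      fix x d :: real assume "x \<in> ?E" "0 < d"
      then obtain i where "0 < snd i" "snd i < d" "x \<in> cball (fst i) (snd i)" "real n < increment \<phi> i / (2 * snd i)"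
        using interval_of_difference_quotient[of "\<lambda>y. real n < y" \<phi> x d] by auto
      then show "\<exists>i. 0 < snd i \<and> snd i < d \<and> x \<in> cball (fst i) (snd i) \<and> real n * (2 * snd i) \<le> increment \<phi> i"
        by (intro exI[of _ i]) (simp add: pos_less_divide_eq)
    qed (use True e n0 in \<open>auto simp: ball_eq_greaterThanLessThan\<close>)
    have "D < real n * (e / 2)" using n e by (simp add: field_simps)
    then have "real n * measure lebesgue T \<le> real n * e"
      using T(3) by (simp add: D_def[symmetric])
    then have "measure lebesgue T \<le> e" using n0 by simp
    then show "\<exists>T. ?E \<subseteq> T \<and> T \<in> lmeasurable \<and> measure lebesgue T \<le> e" using T(1,2) by blast
  qed
qed simp

text \<open>Let \<open>s\<close> be the outer measure of the set. Intervals of slope at most \<open>p\<close> cover it with total length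
  about \<open>s\<close>, so the total increment over them is at most about \<open>p * s\<close>. Intervals of slope at least
  \<open>q\<close> inside the first ones cover it again, so \<open>q * s\<close> is at most that increment. As \<open>p < q\<close>, this
  forces \<open>s = 0\<close>.\<close>

lemma negligible_two_slopes:
  assumes "mono \<phi>" "0 < p" "p < q"
  shows "negligible {x \<in> {-b<..<b}. (\<exists>\<^sub>F h in at 0. difference_quotient \<phi> x h < p) \<and>
    (\<exists>\<^sub>F h in at 0. q < difference_quotient \<phi> x h)}" (is "negligible ?E")
proof -
  define S where "S = {measure lebesgue T | T. T \<in> lmeasurable \<and> ?E \<subseteq> T}"
  define s where "s = Inf S"
  have Sne: "S \<noteq> {}" unfolding S_def using lmeasurable_interval(2)[of "-b" b] by (auto intro!: exI[of _ "{-b<..<b}"])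
  have bdd: "bdd_below S" unfolding S_def by (intro bdd_belowI[of _ 0]) auto
  have s_le: "s \<le> measure lebesgue T" if "T \<in> lmeasurable" "?E \<subseteq> T" for T
    unfolding s_def using bdd that by (intro cInf_lower) (auto simp: S_def)
  have main: "q * s \<le> p * s + (3 * q + p) * \<epsilon>" if \<epsilon>: "0 < \<epsilon>" for \<epsilon>
  proof -
    obtain T where T: "T \<in> lmeasurable" "?E \<subseteq> T" "measure lebesgue T < s + \<epsilon> / 2"
      using cInf_lessD[OF Sne, of "s + \<epsilon> / 2"] \<epsilon> unfolding s_def[symmetric] by (auto simp: S_def)
    obtain U where U: "open U" "T \<subseteq> U" "U - T \<in> lmeasurable" "emeasure lebesgue (U - T) < ennreal (\<epsilon> / 2)"
      using sets_lebesgue_outer_open[OF fmeasurableD[OF T(1)], of "\<epsilon> / 2"] \<epsilon> by auto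
    have "U = T \<union> (U - T)" using U(2) by auto
    then have Um: "U \<in> lmeasurable" and "measure lebesgue U \<le> measure lebesgue T + measure lebesgue (U - T)"
      using fmeasurable.Un[OF T(1) U(3)] measure_Un_le[OF fmeasurableD[OF T(1)] fmeasurableD[OF U(3)]] by auto
    moreover have "measure lebesgue (U - T) < \<epsilon> / 2"
      using U(3,4) \<epsilon> by (simp add: emeasure_eq_measure2 ennreal_less_iff)
    ultimately have Ule: "measure lebesgue U \<le> s + \<epsilon>" using T(3) by simp
    define K where "K = {i. increment \<phi> i \<le> p * (2 * snd i)}"
    have EU: "?E \<subseteq> U" using T(2) U(2) by blast
    have cover: "\<exists>i\<in>K. 0 < snd i \<and> snd i < d \<and> x \<in> cball (fst i) (snd i)" if xE: "x \<in> ?E" and d: "0 < d" for x d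
    proof -
      obtain i where i: "0 < snd i" "snd i < d" "x \<in> cball (fst i) (snd i)" "increment \<phi> i / (2 * snd i) < p"
        using interval_of_difference_quotient[of "\<lambda>y. y < p" \<phi> x d] xE d by auto
      then have "i \<in> K" unfolding K_def by (simp add: pos_divide_less_eq)
      with i show ?thesis by blast
    qed
    obtain F R where F: "finite F" "F \<subseteq> K"
      "\<And>i. i \<in> F \<Longrightarrow> 0 < snd i \<and> cball (fst i) (snd i) \<subseteq> U"
      "pairwise (\<lambda>i j. disjnt (cball (fst i) (snd i)) (cball (fst j) (snd j))) F"
      and R: "R \<in> lmeasurable" "measure lebesgue R < \<epsilon>"
      "?E \<subseteq> (\<Union>i\<in>F. ball (fst i) (snd i)) \<union> R"
      by (rule vitali_finite[OF EU U(1) Um \<epsilon>, of K]) (use cover in \<open>assumption | blast\<close>)+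
    let ?B = "\<Union>i\<in>F. cball (fst i) (snd i)"
    have "(\<Sum>i\<in>F. 2 * snd i) = (\<Sum>i\<in>F. measure lebesgue (cball (fst i) (snd i)))"
      using F(3) by (intro sum.cong refl) (simp add: cball_eq_atLeastAtMost less_imp_le)
    also have "\<dots> = measure lebesgue ?B"
      using F(1,4) by (intro measure_finite_Union[symmetric])
        (auto simp: disjoint_family_on_def pairwise_def disjnt_def fmeasurableD2[OF lmeasurable_cball, simplified])
    also have "\<dots> \<le> measure lebesgue U"
      using F(1,3) Um by (intro measure_mono_fmeasurable) (auto intro: fmeasurableD)
    finally have lenF: "(\<Sum>i\<in>F. 2 * snd i) \<le> s + \<epsilon>" using Ule by simp
    have "(\<Sum>i\<in>F. increment \<phi> i) \<le> (\<Sum>i\<in>F. p * (2 * snd i))"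
      using F(2) unfolding K_def by (intro sum_mono) auto
    also have "\<dots> = p * (\<Sum>i\<in>F. 2 * snd i)" by (simp add: sum_distrib_left)
    also have "\<dots> \<le> p * (s + \<epsilon>)" using lenF assms(2) by simp
    finally have incF: "(\<Sum>i\<in>F. increment \<phi> i) \<le> p * (s + \<epsilon>)" .
    let ?E' = "?E \<inter> (\<Union>i\<in>F. ball (fst i) (snd i))"
    obtain T' where T': "T' \<in> lmeasurable" "?E' \<subseteq> T'"
      "q * measure lebesgue T' \<le> (\<Sum>i\<in>F. increment \<phi> i) + q * \<epsilon>"
    proof (rule steep_points_cover[OF assms(1) F(1) _ F(4), of ?E' q \<epsilon>])
      fix x d :: real assume "x \<in> ?E'" "0 < d"
      then obtain i where "0 < snd i" "snd i < d" "x \<in> cball (fst i) (snd i)" "q < increment \<phi> i / (2 * snd i)"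
        using interval_of_difference_quotient[of "\<lambda>y. q < y" \<phi> x d] by auto
      then show "\<exists>i. 0 < snd i \<and> snd i < d \<and> x \<in> cball (fst i) (snd i) \<and> q * (2 * snd i) \<le> increment \<phi> i"
        by (intro exI[of _ i]) (simp add: pos_less_divide_eq)
    qed (use F(3) \<epsilon> assms(2,3) in auto)
    have "s \<le> measure lebesgue (T' \<union> R)"
      using T'(1,2) R(1,3) by (intro s_le fmeasurable.Un) auto
    also have "\<dots> \<le> measure lebesgue T' + measure lebesgue R"
      using T'(1) R(1) by (intro measure_Un_le fmeasurableD)
    also have "\<dots> \<le> measure lebesgue T' + \<epsilon>" using R(2) by simp
    finally have "q * s \<le> q * (measure lebesgue T' + \<epsilon>)" using assms(2,3) by simp
    then have "q * s \<le> p * (s + \<epsilon>) + q * \<epsilon> + q * \<epsilon>"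
      using T'(3) incF by (simp only: distrib_left)
    moreover have "0 \<le> q * \<epsilon>" using assms(2,3) \<epsilon> by simp
    ultimately show ?thesis by (simp add: algebra_simps)
  qed
  have "q * s \<le> p * s"
  proof (rule field_le_epsilon)
    fix e :: real assume "0 < e"
    then show "q * s \<le> p * s + e"
      using main[of "e / (3 * q + p)"] assms(2,3) by (simp add: zero_less_divide_iff)
  qed
  then have "(q - p) * s \<le> 0" by (simp add: algebra_simps)
  then have "s \<le> 0" using assms(3) by (simp add: mult_le_0_iff)
  show ?thesis
    unfolding negligible_outer
  proof (intro allI impI)
    fix e :: real assume "0 < e"
    then obtain T where "T \<in> lmeasurable" "?E \<subseteq> T" "measure lebesgue T < e"
      using cInf_lessD[OF Sne, of e] \<open>s \<le> 0\<close> unfolding s_def[symmetric] by (auto simp: S_def)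
    then show "\<exists>T. ?E \<subseteq> T \<and> T \<in> lmeasurable \<and> measure lebesgue T < e" by blast
  qed
qed

text \<open>Lebesgue's theorem on monotone functions: where the difference quotients do not converge they are
  unbounded or oscillate between two rationals.\<close>

theorem mono_differentiable_ae:
  fixes \<phi> :: "real \<Rightarrow> real"
  assumes "mono \<phi>"
  shows "negligible {x. \<not> \<phi> differentiable (at x)}"
proof -
  let ?A = "\<lambda>b. {x \<in> {-b<..<b}. \<forall>n::nat. \<exists>\<^sub>F h in at 0. real n < difference_quotient \<phi> x h}"
  let ?B = "\<lambda>p q b. {x \<in> {-b<..<b}. (\<exists>\<^sub>F h in at 0. difference_quotient \<phi> x h < p) \<and>
    (\<exists>\<^sub>F h in at 0. q < difference_quotient \<phi> x h)}"
  define I where "I = {(p, q). p \<in> \<rat> \<and> q \<in> \<rat> \<and> 0 < p \<and> p < (q::real)}"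
  have "countable (\<rat> \<times> (\<rat> :: real set))" by (intro countable_SIGMA countable_rat)
  then have "countable I" unfolding I_def by (rule countable_subset[rotated]) auto
  have nonneg: "0 \<le> difference_quotient \<phi> x h" for x h
    using monoD[OF assms, of x "x + h"] monoD[OF assms, of "x + h" x]
    unfolding difference_quotient_def by (cases "0 \<le> h") (auto simp: divide_nonpos_nonpos)
  have "negligible (\<Union>b::nat. ?A (real b) \<union> (\<Union>i\<in>I. ?B (fst i) (snd i) (real b)))"
  proof (rule negligible_countable_Union[of "range _"], goal_cases)
    case (2 S)
    then obtain b :: nat where b: "S = ?A (real b) \<union> (\<Union>i\<in>I. ?B (fst i) (snd i) (real b))" by blast
    have "negligible (\<Union>i\<in>I. ?B (fst i) (snd i) (real b))"
      using \<open>countable I\<close> negligible_two_slopes[OF assms]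
      by (intro negligible_countable_Union) (auto simp: I_def)
    then show ?case unfolding b using negligible_infinite_slope[OF assms] by (intro negligible_Un)
  qed simp
  moreover have "\<phi> differentiable (at x)" if x: "x \<notin> (\<Union>b::nat. ?A (real b) \<union> (\<Union>i\<in>I. ?B (fst i) (snd i) (real b)))" for x
  proof -
    obtain b :: nat where "\<bar>x\<bar> < real b" using reals_Archimedean2 by blast
    then have b: "x \<in> {-real b<..<real b}" by auto
    then obtain n :: nat where n: "\<not> (\<exists>\<^sub>F h in at 0. real n < difference_quotient \<phi> x h)" using x by auto
    have "\<exists>L. (difference_quotient \<phi> x \<longlongrightarrow> L) (at 0)"
    proof (rule tendsto_if_no_oscillation)
      show "\<forall>\<^sub>F h in at 0. \<bar>difference_quotient \<phi> x h\<bar> \<le> real n"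
        using n nonneg by (simp add: not_frequently not_less)
    next
      fix p q assume pq: "p \<in> \<rat>" "q \<in> \<rat>" "p < q" and f: "\<exists>\<^sub>F h in at 0. difference_quotient \<phi> x h < p"
      have "0 < p" using f nonneg by (auto dest!: frequently_ex intro: order.strict_trans1)
      then have "(p, q) \<in> I" using pq by (simp add: I_def)
      then have "\<not> (\<exists>\<^sub>F h in at 0. q < difference_quotient \<phi> x h)" using x b f by fastforce
      then show "\<forall>\<^sub>F h in at 0. difference_quotient \<phi> x h \<le> q" by (simp add: not_frequently not_less)
    qed simp
    then show ?thesis
      unfolding real_differentiable_def DERIV_def difference_quotient_def[abs_def] .
  qed
  ultimately show ?thesis
    by (elim negligible_subset) blast
qed

text \<open>Once \<open>\<phi>\<close> has increased from \<open>a\<close> to \<open>b\<close> it cannot decrease any more in that direction, since \<open>b\<close>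
  lies between \<open>a\<close> and all later points.\<close>

lemma quasiconvex_real_ray:
  fixes \<phi> :: "real \<Rightarrow> real"
  assumes "quasiconvex \<phi>" "\<phi> a < \<phi> b" "a \<noteq> b" "0 \<le> s" "s \<le> t"
  shows "\<phi> (b + s * (b - a)) \<le> \<phi> (b + t * (b - a))"
proof -
  have qc: "\<phi> (l * x + (1 - l) * y) \<le> max (\<phi> x) (\<phi> y)" if "0 \<le> l" "l \<le> 1" for l x y
    using assms(1) that unfolding quasiconvex_def by fastforce
  have above: "\<phi> b \<le> \<phi> (b + t * (b - a))" if "0 \<le> t" for t
  proof -
    let ?l = "t / (1 + t)"
    have "?l * a + (1 - ?l) * (b + t * (b - a)) = b"
      using that by (simp add: divide_simps) (simp add: algebra_simps)
    then have "\<phi> b \<le> max (\<phi> a) (\<phi> (b + t * (b - a)))"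
      using qc[of ?l a "b + t * (b - a)"] that by simp
    then show ?thesis using assms(2) by auto
  qed
  let ?l = "(t - s) / (1 + t)"
  have "?l * a + (1 - ?l) * (b + t * (b - a)) = b + s * (b - a)"
    using assms(4,5) by (simp add: divide_simps) (simp add: algebra_simps)
  then have "\<phi> (b + s * (b - a)) \<le> max (\<phi> a) (\<phi> (b + t * (b - a)))"
    using qc[of ?l a "b + t * (b - a)"] assms(4,5) by simp
  then show ?thesis using above[of t] assms(2,4,5) by auto
qed

lemma quasiconvex_real_mono_right:
  assumes "quasiconvex \<phi>" "\<phi> a < \<phi> b" "a < b" "b \<le> x" "x \<le> y"
  shows "\<phi> x \<le> \<phi> (y::real)"
  using quasiconvex_real_ray[OF assms(1,2), of "(x - b) / (b - a)" "(y - b) / (b - a)"] assms(3-5)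
  by (simp add: divide_right_mono)

text \<open>A quasiconvex function on the line decreases and then increases, so it is monotone near every point
  with at most one exception, the turning point.\<close>

theorem quasiconvex_real_differentiable_ae:
  fixes \<phi> :: "real \<Rightarrow> real"
  assumes "quasiconvex \<phi>"
  shows "negligible {x. \<not> \<phi> differentiable (at x)}"
proof -
  let ?N = "\<lambda>\<psi>. {x. \<not> \<psi> differentiable (at (x::real))}"
  define P where "P = {r. \<forall>x y. r \<le> x \<longrightarrow> x \<le> y \<longrightarrow> \<phi> x \<le> \<phi> y}"
  define M where "M = {r. \<forall>x y. x \<le> y \<longrightarrow> y \<le> r \<longrightarrow> \<phi> y \<le> \<phi> x}"
  \<comment> \<open>To the right of a rational in \<open>P\<close> and to the left of one in \<open>M\<close> the function is monotone; \<open>Z\<close> is the rest.\<close>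
  define Z where "Z = {x. (\<forall>r\<in>\<rat>. r < x \<longrightarrow> r \<notin> P) \<and> (\<forall>r\<in>\<rat>. x < r \<longrightarrow> r \<notin> M)}"
  have right: "negligible (?N \<phi> \<inter> {r<..})" if "r \<in> P" for r
  proof -
    have "mono (\<lambda>x. \<phi> (max x r))"
      using that unfolding P_def by (intro monoI) auto
    moreover have "?N \<phi> \<inter> {r<..} \<subseteq> ?N (\<lambda>x. \<phi> (max x r))"
    proof safe
      fix x assume "r < x" and d: "(\<lambda>x. \<phi> (max x r)) differentiable at x" and "\<not> \<phi> differentiable at x"
      have "\<phi> differentiable at x"
        by (rule differentiable_transform_within[OF d, of "x - r"]) (use \<open>r < x\<close> in \<open>auto simp: dist_real_def max_def\<close>)
      with \<open>\<not> \<phi> differentiable at x\<close> show False by simp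
    qed
    ultimately show ?thesis using mono_differentiable_ae negligible_subset by blast
  qed
  have left: "negligible (?N \<phi> \<inter> {..<r})" if "r \<in> M" for r
  proof -
    have "mono (\<lambda>x. - \<phi> (min x r))"
      using that unfolding M_def by (intro monoI) auto
    moreover have "?N \<phi> \<inter> {..<r} \<subseteq> ?N (\<lambda>x. - \<phi> (min x r))"
    proof safe
      fix x assume "x < r" and d: "(\<lambda>x. - \<phi> (min x r)) differentiable at x" and "\<not> \<phi> differentiable at x"
      have "\<phi> differentiable at x"
        by (rule differentiable_transform_within[OF differentiable_minus[OF d], of "r - x"])
          (use \<open>x < r\<close> in \<open>auto simp: dist_real_def min_def\<close>)
      with \<open>\<not> \<phi> differentiable at x\<close> show False by simp
    qed
    ultimately show ?thesis using mono_differentiable_ae negligible_subset by blast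
  qed
  have "x = y" if xy: "x \<in> Z" "y \<in> Z" "x \<le> y" for x y
  proof (rule ccontr)
    assume "x \<noteq> y"
    with xy obtain r where r: "r \<in> \<rat>" "x < r" "r < y" using Rats_dense_in_real[of x y] by auto
    then have "r \<notin> P" "r \<notin> M" using xy unfolding Z_def by auto
    then obtain a b where ab: "a \<le> b" "b \<le> r" "\<phi> a < \<phi> b" unfolding M_def by (auto simp: not_le)
    then have "a < b" by (cases "a = b") auto
    then have "r \<in> P" unfolding P_def
      using quasiconvex_real_mono_right[OF assms ab(3)] ab(2) by auto
    with \<open>r \<notin> P\<close> show False by simp
  qed
  then have "Z \<subseteq> {z}" if "z \<in> Z" for z using that by (metis linear singletonI subsetI)
  then have "negligible Z" by (metis ex_in_conv negligible_empty negligible_sing negligible_subset)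
  moreover have "negligible (\<Union>r\<in>\<rat> \<inter> P. ?N \<phi> \<inter> {r<..})"
    using right countable_rat by (intro negligible_countable_Union) (auto intro: countable_Int1)
  moreover have "negligible (\<Union>r\<in>\<rat> \<inter> M. ?N \<phi> \<inter> {..<r})"
    using left countable_rat by (intro negligible_countable_Union) (auto intro: countable_Int1)
  ultimately have "negligible (Z \<union> (\<Union>r\<in>\<rat> \<inter> P. ?N \<phi> \<inter> {r<..}) \<union> (\<Union>r\<in>\<rat> \<inter> M. ?N \<phi> \<inter> {..<r}))"
    by (intro negligible_Un)
  then show ?thesis
    by (rule negligible_subset) (auto simp: Z_def)
qed

section \<open>Sets with a directional null cover\<close>

text \<open>For a fixed sequence \<open>\<xi>\<close>, the \<open>\<sigma>\<close>-ideal of the subsets of sets decomposable as in the definition of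
  Aronszajn null sets. The members need not be Borel, so that exceptional sets can be collected freely.\<close>

definition null_cover :: "(nat \<Rightarrow> 'a::real_normed_vector) \<Rightarrow> 'a set \<Rightarrow> bool"
  where "null_cover \<xi> S \<longleftrightarrow> (\<exists>E :: nat \<Rightarrow> 'a set. (\<forall>n. E n \<in> sets borel) \<and> S \<subseteq> (\<Union>n. E n) \<and>
    (\<forall>n x. {t. x + t *\<^sub>R \<xi> n \<in> E n} \<in> null_sets lborel))"

lemma null_cover_subset: "null_cover \<xi> T \<Longrightarrow> S \<subseteq> T \<Longrightarrow> null_cover \<xi> S"
  unfolding null_cover_def by (meson order_trans)

lemma null_cover_UN_nat:
  assumes "\<And>k::nat. null_cover \<xi> (S k)"
  shows "null_cover \<xi> (\<Union>k. S k)"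
proof -
  obtain E where E: "\<And>k n. E k n \<in> sets borel" "\<And>k. S k \<subseteq> (\<Union>n. E k n)"
    "\<And>k n x. {t. x + t *\<^sub>R \<xi> n \<in> E k n} \<in> null_sets lborel"
    using assms unfolding null_cover_def by metis
  have "{t. x + t *\<^sub>R \<xi> n \<in> (\<Union>k. E k n)} \<in> null_sets lborel" for n x
  proof -
    have "{t. x + t *\<^sub>R \<xi> n \<in> (\<Union>k. E k n)} = (\<Union>k. {t. x + t *\<^sub>R \<xi> n \<in> E k n})" by auto
    then show ?thesis by (simp only:) (intro null_sets_UN E(3))
  qed
  moreover have "(\<Union>k. S k) \<subseteq> (\<Union>n. \<Union>k. E k n)" 
  proof (rule UN_least)
    fix k
    have "E k n \<subseteq> (\<Union>k. E k n)" for n by (rule UN_upper) simp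
    then show "S k \<subseteq> (\<Union>n. \<Union>k. E k n)" 
      by (intro order_trans[OF E(2)[of k]] UN_mono order_refl)
  qed
  moreover have "(\<Union>k. E k n) \<in> sets borel" for n using E(1) by (intro sets.countable_UN) auto
  ultimately show ?thesis
    unfolding null_cover_def by (intro exI[of _ "\<lambda>n. \<Union>k. E k n"] conjI allI)
qed

lemma null_cover_borel:
  assumes "B \<in> sets borel" "\<And>x. negligible {t. x + t *\<^sub>R \<xi> n \<in> B}"
  shows "null_cover \<xi> B"
proof -
  have "{t. x + t *\<^sub>R \<xi> n \<in> B} \<in> null_sets lborel" for x
  proof -
    have "(\<lambda>t. x + t *\<^sub>R \<xi> n) \<in> borel_measurable borel"
      by (intro borel_measurable_continuous_onI continuous_intros)
    from measurable_sets[OF this assms(1)] have "{t. x + t *\<^sub>R \<xi> n \<in> B} \<in> sets lborel"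
      by (simp add: vimage_def)
    then show ?thesis using assms(2)[of x]
      by (simp add: negligible_iff_null_sets null_sets_completion_iff)
  qed
  then show ?thesis
    unfolding null_cover_def using assms(1)
    by (intro exI[of _ "\<lambda>k. if k = n then B else {}"]) auto
qed

lemma null_cover_empty: "null_cover \<xi> {}"
  by (rule null_cover_borel[of _ _ 0]) auto

lemma null_cover_UN:
  assumes "countable I" "\<And>i. i \<in> I \<Longrightarrow> null_cover \<xi> (S i)"
  shows "null_cover \<xi> (\<Union>i\<in>I. S i)"
proof (cases "I = {}")
  case False
  then have "(\<Union>i\<in>I. S i) = (\<Union>k. S (from_nat_into I k))"
    using range_from_nat_into[OF False assms(1)] by (metis image_image)
  then show ?thesis
    using null_cover_UN_nat[of \<xi> "\<lambda>k. S (from_nat_into I k)"] assms(2) from_nat_into[OF False] by simp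
qed (simp add: null_cover_empty)

lemma null_cover_Un: "null_cover \<xi> S \<Longrightarrow> null_cover \<xi> T \<Longrightarrow> null_cover \<xi> (S \<union> T)"
  using null_cover_UN[of "{S, T}" \<xi> id] by auto

text \<open>The cover may consist of sets larger than \<open>A\<close>, since its members can be intersected with the Borel
  set \<open>A\<close>.\<close>

lemma aronszajn_nullI:
  assumes "A \<in> sets borel"
    and "\<And>\<xi> :: nat \<Rightarrow> 'a. closure (span (range \<xi>)) = UNIV \<Longrightarrow> null_cover \<xi> A"
  shows "aronszajn_null (A :: 'a::real_normed_vector set)"
  unfolding aronszajn_null_def
proof (intro conjI allI impI assms(1))
  fix \<xi> :: "nat \<Rightarrow> 'a" assume "closure (span (range \<xi>)) = UNIV"
  from assms(2)[OF this] obtain E where E: "\<And>n. E n \<in> sets borel" "A \<subseteq> (\<Union>n. E n)"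
    "\<And>n x. {t. x + t *\<^sub>R \<xi> n \<in> E n} \<in> null_sets lborel"
    unfolding null_cover_def by blast
  have "{t. x + t *\<^sub>R \<xi> n \<in> E n \<inter> A} \<in> null_sets lborel" for n x
  proof (rule null_sets_subset[OF E(3)[of x n]])
    have "(\<lambda>t. x + t *\<^sub>R \<xi> n) \<in> borel_measurable borel"
      by (intro borel_measurable_continuous_onI continuous_intros)
    from measurable_sets[OF this, of "E n \<inter> A"] show "{t. x + t *\<^sub>R \<xi> n \<in> E n \<inter> A} \<in> sets lborel"
      using E(1) assms(1) by (simp add: vimage_def)
  qed auto
  moreover have "A = (\<Union>n. E n \<inter> A)" using E(2) by auto
  ultimately show "\<exists>E. (\<forall>n. E n \<in> sets borel) \<and> A = (\<Union>n. E n) \<and>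
      (\<forall>n x. {t. x + t *\<^sub>R \<xi> n \<in> E n} \<in> null_sets lborel)"
    using E(1) assms(1) by (intro exI[of _ "\<lambda>n. E n \<inter> A"]) auto
qed

section \<open>Porosity\<close>

text \<open>The points at which \<open>A\<close> is porous in direction \<open>u\<close>: arbitrarily small steps \<open>t u\<close> lead to the centre of a
  hole of \<open>A\<close> with radius \<open>c t\<close>.\<close>

definition porous_points :: "'a::real_normed_vector \<Rightarrow> real \<Rightarrow> 'a set \<Rightarrow> 'a set"
  where "porous_points u c A = {x\<in>A. \<forall>\<delta>>0. \<exists>t. 0 < t \<and> t < \<delta> \<and> ball (x + t *\<^sub>R u) (c * t) \<inter> A = {}}"

lemma not_porousE:
  assumes "x \<in> A" "x \<notin> porous_points u c A"
  obtains \<delta> where "0 < \<delta>" "\<And>t. 0 < t \<Longrightarrow> t < \<delta> \<Longrightarrow> \<exists>a\<in>A. norm (a - (x + t *\<^sub>R u)) < c * t"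
proof -
  obtain \<delta> where "0 < \<delta>" "\<And>t. 0 < t \<Longrightarrow> t < \<delta> \<Longrightarrow> ball (x + t *\<^sub>R u) (c * t) \<inter> A \<noteq> {}"
    using assms unfolding porous_points_def by blast
  moreover from this(2) have "\<exists>a\<in>A. norm (a - (x + t *\<^sub>R u)) < c * t" if "0 < t" "t < \<delta>" for t
    using that by (fastforce simp: dist_norm norm_minus_commute)
  ultimately show thesis using that by blast
qed

lemma porous_points_zero: "0 < c \<Longrightarrow> porous_points 0 c A = {}"
proof -
  assume "0 < c"
  have "x \<in> ball (x + t *\<^sub>R 0) (c * t)" if "0 < t" for x :: 'a and t using that \<open>0 < c\<close> by simp
  then show ?thesis unfolding porous_points_def using zero_less_one by blast
qed

text \<open>The distance is Lipschitz along the line, so a linear function makes it monotone.\<close>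

lemma infdist_line_differentiable_ae:
  fixes A :: "'a::real_normed_vector set"
  shows "negligible {s. \<not> (\<lambda>t. infdist (x + t *\<^sub>R v) A) differentiable (at s)}"
proof -
  let ?d = "\<lambda>t. infdist (x + t *\<^sub>R v) A"
  have "?d s + s * norm v \<le> ?d t + t * norm v" if "s \<le> t" for s t
  proof -
    have "dist (x + s *\<^sub>R v) (x + t *\<^sub>R v) = (t - s) * norm v"
      using that by (simp add: dist_norm scaleR_diff_left[symmetric])
    then show ?thesis
      using infdist_triangle[of "x + s *\<^sub>R v" A "x + t *\<^sub>R v"] by (simp add: algebra_simps)
  qed
  then have "mono (\<lambda>t. ?d t + t * norm v)" by (intro monoI)
  from mono_differentiable_ae[OF this] show ?thesis
  proof (rule negligible_subset, safe)
    fix s assume "\<not> ?d differentiable at s" and "(\<lambda>t. ?d t + t * norm v) differentiable at s"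
    from differentiable_diff[OF this(2), of "\<lambda>t. t * norm v"] this(1) show False by simp
  qed
qed

definition far_points :: "'a::real_normed_vector \<Rightarrow> real \<Rightarrow> 'a set \<Rightarrow> 'a set"
  where "far_points u c A = closure A \<inter>
    (\<Inter>k::nat. \<Union>t\<in>{0<..<1 / Suc k}. {x. c * t < infdist (x + t *\<^sub>R u) A})"

lemma far_points_borel: "far_points u c A \<in> sets borel"
proof -
  have "open (\<Union>t\<in>{0<..<1 / real (Suc k)}. {x. c * t < infdist (x + t *\<^sub>R u) A})" for k
    by (intro open_UN ballI open_Collect_less continuous_intros)
  then show ?thesis unfolding far_points_def by (intro sets.Int sets.countable_INT) auto
qed

text \<open>Membership in \<open>porous_points\<close> depends on \<open>A\<close> itself and need not be a Borel condition. The larger set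
  \<open>far_points\<close> depends only on the closure of \<open>A\<close>; halving \<open>c\<close> makes the inequality strict, hence open.\<close>

lemma porous_subset_far:
  assumes "0 < c" shows "porous_points u c A \<subseteq> far_points u (c / 2) A"
proof
  fix x assume x: "x \<in> porous_points u c A"
  then have "A \<noteq> {}" "x \<in> closure A" using closure_subset unfolding porous_points_def by auto
  have "\<exists>t\<in>{0<..<1 / real (Suc k)}. c / 2 * t < infdist (x + t *\<^sub>R u) A" for k
  proof -
    obtain t where t: "0 < t" "t < 1 / real (Suc k)" "ball (x + t *\<^sub>R u) (c * t) \<inter> A = {}"
      using x unfolding porous_points_def by (auto dest: spec[of _ "1 / real (Suc k)"])
    have "c * t \<le> infdist (x + t *\<^sub>R u) A"
      unfolding infdist_notempty[OF \<open>A \<noteq> {}\<close>] using t(3) by (intro cINF_greatest \<open>A \<noteq> {}\<close>) (force simp: not_less)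
    moreover have "c / 2 * t < c * t" using assms t(1) by simp
    ultimately show ?thesis using t by (intro bexI[of _ t]) auto
  qed
  with \<open>x \<in> closure A\<close> show "x \<in> far_points u (c / 2) A" unfolding far_points_def by auto
qed

text \<open>At a point of the closure the distance to \<open>A\<close> is minimal, so its derivative along the line would have
  to be \<open>0\<close>; but the distance grows linearly along a sequence of steps tending to \<open>0\<close>. So such points
  are points of non-differentiability of the distance function.\<close>

lemma far_points_line_negligible:
  assumes "0 < c"
  shows "negligible {s. x + s *\<^sub>R v \<in> far_points (a *\<^sub>R v) c A}"
proof (rule negligible_subset[OF infdist_line_differentiable_ae[of x v A]], safe)
  fix s assume far: "x + s *\<^sub>R v \<in> far_points (a *\<^sub>R v) c A"
    and "(\<lambda>t. infdist (x + t *\<^sub>R v) A) differentiable at s"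
  then obtain D where D: "((\<lambda>t. infdist (x + t *\<^sub>R v) A) has_real_derivative D) (at s)"
    by (auto simp: real_differentiable_def)
  have cl: "x + s *\<^sub>R v \<in> closure A" using far unfolding far_points_def by simp
  then have "A \<noteq> {}" by auto
  with cl have s0: "infdist (x + s *\<^sub>R v) A = 0" by (simp add: in_closure_iff_infdist_zero)
  have "D = 0"
    by (rule DERIV_local_min[OF D zero_less_one]) (simp add: s0 infdist_nonneg)
  with D have "((\<lambda>h. infdist (x + (s + h) *\<^sub>R v) A / h) \<longlongrightarrow> 0) (at 0)"
    by (simp add: DERIV_def s0)
  from tendstoD[OF this, of "c / (1 + \<bar>a\<bar>)"] assms obtain \<delta> where \<delta>: "0 < \<delta>"
    "\<And>h. h \<noteq> 0 \<Longrightarrow> \<bar>h\<bar> < \<delta> \<Longrightarrow> infdist (x + (s + h) *\<^sub>R v) A / \<bar>h\<bar> < c / (1 + \<bar>a\<bar>)"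
    by (auto simp: eventually_at infdist_nonneg)
  obtain k :: nat where k: "1 / Suc k < \<delta> / (1 + \<bar>a\<bar>)"
    using nat_approx_posE[of "\<delta> / (1 + \<bar>a\<bar>)"] \<delta>(1) by auto
  obtain t where t: "0 < t" "t < 1 / real (Suc k)" "c * t < infdist (x + s *\<^sub>R v + t *\<^sub>R a *\<^sub>R v) A"
    using INT_D[OF IntD2[OF far[unfolded far_points_def]] UNIV_I[of k]] by (elim UN_E) auto
  have "a \<noteq> 0" using t s0 assms by (auto simp: mult_less_0_iff)
  have "t < \<delta> / (1 + \<bar>a\<bar>)" using t(2) k by (rule order.strict_trans)
  then have "t * (1 + \<bar>a\<bar>) < \<delta>" by (simp add: pos_less_divide_eq add_pos_nonneg)
  then have "\<bar>t * a\<bar> < \<delta>" using t(1) by (simp add: abs_mult algebra_simps)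
  then have "infdist (x + (s + t * a) *\<^sub>R v) A / \<bar>t * a\<bar> < c / (1 + \<bar>a\<bar>)"
    using \<delta>(2)[of "t * a"] t(1) \<open>a \<noteq> 0\<close> by simp
  then have "infdist (x + (s + t * a) *\<^sub>R v) A < c / (1 + \<bar>a\<bar>) * \<bar>t * a\<bar>"
    using t(1) \<open>a \<noteq> 0\<close> by (simp add: pos_divide_less_eq)
  also have "\<dots> \<le> c * t"
    using assms t(1) by (simp add: abs_mult divide_simps)
  finally show False using t(3) by (simp add: scaleR_add_left add.assoc)
qed

lemma porous_line_negligible:
  assumes "0 < c"
  shows "negligible {s. x + s *\<^sub>R v \<in> porous_points (a *\<^sub>R v) c A}"
  using porous_subset_far[OF assms, of "a *\<^sub>R v" A]
  by (intro negligible_subset[OF far_points_line_negligible[of "c / 2" x v a A]]) (use assms in auto)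

lemma null_cover_porous_basic:
  assumes "0 < c" shows "null_cover \<xi> (porous_points (a *\<^sub>R \<xi> n) c A)"
  by (rule null_cover_subset[OF null_cover_borel[of _ \<xi> n] porous_subset_far[OF assms]])
    (use assms in \<open>auto intro: far_points_borel far_points_line_negligible\<close>)

text \<open>Let \<open>B k\<close> consist of the points of \<open>A\<close> from which, for all \<open>t < 1 / (k + 1)\<close>, a step \<open>t v\<close> leads close to
  \<open>A\<close>. If \<open>x \<in> B k\<close> and small steps \<open>t u\<close> from \<open>x\<close> lead close to points of \<open>B k\<close>, then a further step \<open>t v\<close>
  leads close to \<open>A\<close>, and \<open>A\<close> is not porous at \<open>x\<close> in direction \<open>u + v\<close>.\<close>

lemma null_cover_porous_add:
  assumes "\<And>c A. 0 < c \<Longrightarrow> null_cover \<xi> (porous_points u c A)"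
    and "\<And>c A. 0 < c \<Longrightarrow> null_cover \<xi> (porous_points v c A)" and "0 < c"
  shows "null_cover \<xi> (porous_points (u + v) c A)"
proof -
  define B where "B k = {x\<in>A. \<forall>t. 0 < t \<longrightarrow> t < 1 / real (Suc k) \<longrightarrow> (\<exists>a\<in>A. norm (a - (x + t *\<^sub>R v)) < c / 2 * t)}" for k :: nat
  have "porous_points (u + v) c A \<subseteq> porous_points v (c / 2) A \<union> (\<Union>k. porous_points u (c / 2) (B k))"
  proof
    fix x assume x: "x \<in> porous_points (u + v) c A"
    then have "x \<in> A" unfolding porous_points_def by simp
    show "x \<in> porous_points v (c / 2) A \<union> (\<Union>k. porous_points u (c / 2) (B k))"
    proof (rule ccontr)
      assume n: "\<not> ?thesis"
      then obtain \<delta> where \<delta>: "0 < \<delta>" "\<And>t. 0 < t \<Longrightarrow> t < \<delta> \<Longrightarrow> \<exists>a\<in>A. norm (a - (x + t *\<^sub>R v)) < c / 2 * t"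
        using not_porousE[OF \<open>x \<in> A\<close>, of v "c / 2"] by auto
      obtain k :: nat where k: "1 / Suc k < \<delta>" using nat_approx_posE[OF \<delta>(1)] by auto
      have "x \<in> B k" using \<open>x \<in> A\<close> \<delta>(2) k unfolding B_def by auto
      then obtain \<delta>' where \<delta>': "0 < \<delta>'" "\<And>t. 0 < t \<Longrightarrow> t < \<delta>' \<Longrightarrow> \<exists>a\<in>B k. norm (a - (x + t *\<^sub>R u)) < c / 2 * t"
        using not_porousE[of x "B k" u "c / 2"] n by auto
      obtain t where t: "0 < t" "t < min \<delta>' (1 / Suc k)" "ball (x + t *\<^sub>R (u + v)) (c * t) \<inter> A = {}"
        using x \<delta>'(1) unfolding porous_points_def by (auto dest: spec[of _ "min \<delta>' (1 / Suc k)"])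
      obtain a where a: "a \<in> B k" "norm (a - (x + t *\<^sub>R u)) < c / 2 * t" using \<delta>'(2)[of t] t by auto
      then obtain b where b: "b \<in> A" "norm (b - (a + t *\<^sub>R v)) < c / 2 * t"
        using t unfolding B_def by auto
      have "norm (b - (x + t *\<^sub>R (u + v))) \<le> norm (b - (a + t *\<^sub>R v)) + norm (a - (x + t *\<^sub>R u))"
        using norm_triangle_ineq[of "b - (a + t *\<^sub>R v)" "a - (x + t *\<^sub>R u)"] by (simp add: algebra_simps)
      also have "\<dots> < c * t" using a(2) b(2) by simp
      finally have "b \<in> ball (x + t *\<^sub>R (u + v)) (c * t)" by (simp add: dist_norm norm_minus_commute)
      with b(1) t(3) show False by blast
    qed
  qed
  moreover have "null_cover \<xi> (porous_points v (c / 2) A \<union> (\<Union>k. porous_points u (c / 2) (B k)))"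
    using assms by (intro null_cover_Un null_cover_UN_nat) auto
  ultimately show ?thesis using null_cover_subset by blast
qed

lemma null_cover_porous_span:
  assumes "u \<in> span (range \<xi>)" "0 < c" shows "null_cover \<xi> (porous_points u c A)"
proof -
  have "\<forall>c A. 0 < c \<longrightarrow> null_cover \<xi> (porous_points u c A)"
    using assms(1)
  proof (induction rule: span_induct_alt)
    case base
    then show ?case by (simp add: porous_points_zero null_cover_empty)
  next
    case (step a v w)
    then show ?case using null_cover_porous_basic null_cover_porous_add by blast
  qed
  then show ?thesis using assms(2) by blast
qed

text \<open>A direction in the closed span is as good as a nearby one in the span, at the cost of halving the
  radius of the holes.\<close>

theorem null_cover_porous:
  assumes "closure (span (range \<xi>)) = UNIV" "0 < c"
  shows "null_cover \<xi> (porous_points u c A)"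
proof -
  obtain v where v: "v \<in> span (range \<xi>)" "norm (v - u) < c / 2"
    using assms closure_approachable[of u "span (range \<xi>)"] by (metis UNIV_I dist_norm half_gt_zero)
  have "ball (x + t *\<^sub>R v) (c / 2 * t) \<subseteq> ball (x + t *\<^sub>R u) (c * t)" if "0 < t" for x t
  proof
    fix y assume "y \<in> ball (x + t *\<^sub>R v) (c / 2 * t)"
    then have "dist (x + t *\<^sub>R v) y < c / 2 * t" by simp
    moreover have "dist (x + t *\<^sub>R u) (x + t *\<^sub>R v) = t * norm (v - u)"
      using that by (simp add: dist_norm scaleR_diff_right[symmetric] norm_minus_commute)
    moreover have "t * norm (v - u) < c / 2 * t" using v(2) that by (simp add: mult.commute)
    ultimately show "y \<in> ball (x + t *\<^sub>R u) (c * t)"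
      using dist_triangle[of "x + t *\<^sub>R u" y "x + t *\<^sub>R v"] by simp
  qed
  then have "porous_points u c A \<subseteq> porous_points v (c / 2) A"
    unfolding porous_points_def by blast
  then show ?thesis
    using null_cover_porous_span[OF v(1), of "c / 2" A] assms(2) by (simp add: null_cover_subset)
qed

section \<open>Robust directional derivatives\<close>

text \<open>The points at which \<open>g\<close> is approximately affine in direction \<open>d\<close>, with slope \<open>y\<close> and error \<open>\<eta>\<close>, at the scale
  \<open>\<delta>\<close>, and this up to displacements \<open>h\<close>, at a price of \<open>m\<close> per unit. The displacements make the set closed
  even if \<open>g\<close> is not Borel measurable; with \<open>t = 0\<close> they include a Lipschitz condition at the point.\<close>

definition approx_points :: "('a::real_normed_vector \<Rightarrow> real) \<Rightarrow> real \<Rightarrow> 'a \<Rightarrow> real \<Rightarrow> real \<Rightarrow> real \<Rightarrow> 'a set"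
  where "approx_points g m d y \<eta> \<delta> = {x. \<forall>t h. \<bar>t\<bar> < \<delta> \<longrightarrow> norm h < \<delta> \<longrightarrow>
    \<bar>g (x + t *\<^sub>R d + h) - g x - t * y\<bar> \<le> \<eta> * \<bar>t\<bar> + m * norm h}"

lemma approx_pointsD:
  assumes "x \<in> approx_points g m d y \<eta> \<delta>" "\<bar>t\<bar> < \<delta>" "norm h < \<delta>"
  shows "\<bar>g (x + t *\<^sub>R d + h) - g x - t * y\<bar> \<le> \<eta> * \<bar>t\<bar> + m * norm h"
  using assms unfolding approx_points_def by blast

lemma approx_points_lipschitz:
  assumes "x \<in> approx_points g m d y \<eta> \<delta>" "norm h < \<delta>"
  shows "\<bar>g (x + h) - g x\<bar> \<le> m * norm h"
  using approx_pointsD[OF assms(1), of 0 h] assms(2) norm_ge_zero[of h] by auto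

text \<open>A limit \<open>x\<close> of points \<open>X n\<close> of the set is reached from \<open>X n\<close> by the displacement \<open>x - X n\<close>, which may be
  absorbed into \<open>h\<close>; with \<open>t = 0\<close> this also gives the convergence of \<open>g (X n)\<close> to \<open>g x\<close>.\<close>

lemma closed_approx_points: "closed (approx_points g m d y \<eta> \<delta>)"
  unfolding closed_sequential_limits
proof (intro allI impI, elim conjE)
  fix X x assume X: "\<forall>n::nat. X n \<in> approx_points g m d y \<eta> \<delta>" and lim: "X \<longlonglongrightarrow> x"
  have d0: "(\<lambda>n. x - X n) \<longlonglongrightarrow> 0" using tendsto_diff[OF tendsto_const lim, of x] by simp
  show "x \<in> approx_points g m d y \<eta> \<delta>"
    unfolding approx_points_def
  proof (intro CollectI allI impI)
    fix t :: real and h :: 'a assume t: "\<bar>t\<bar> < \<delta>" and h: "norm h < \<delta>"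
    then have "0 < \<delta>" using norm_ge_zero[of h] by linarith
    have small: "\<forall>\<^sub>F n in sequentially. norm (x - X n) < \<delta>"
      using tendstoD[OF d0 \<open>0 < \<delta>\<close>] by (simp add: dist_norm)
    have "(\<lambda>n. g x - g (X n)) \<longlonglongrightarrow> 0"
    proof (rule Lim_null_comparison)
      show "\<forall>\<^sub>F n in sequentially. norm (g x - g (X n)) \<le> m * norm (x - X n)"
        using small
      proof eventually_elim
        case (elim n)
        then show ?case using approx_points_lipschitz[OF X[rule_format, of n], of "x - X n"] by simp
      qed
      show "(\<lambda>n. m * norm (x - X n)) \<longlonglongrightarrow> 0"
        using tendsto_mult_left[OF tendsto_norm[OF d0], of m] by simp
    qed
    from tendsto_diff[OF tendsto_const this, of "g x"]
    have "(\<lambda>n. g (X n)) \<longlonglongrightarrow> g x" by simp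
    then have "(\<lambda>n. \<bar>g (x + t *\<^sub>R d + h) - g (X n) - t * y\<bar>) \<longlonglongrightarrow> \<bar>g (x + t *\<^sub>R d + h) - g x - t * y\<bar>"
      by (intro tendsto_intros)
    moreover have d1: "(\<lambda>n. h + (x - X n)) \<longlonglongrightarrow> h + 0" by (intro tendsto_intros d0)
    then have "(\<lambda>n. \<eta> * \<bar>t\<bar> + m * norm (h + (x - X n))) \<longlonglongrightarrow> \<eta> * \<bar>t\<bar> + m * norm (h + 0)"
      by (rule tendsto_add[OF tendsto_const tendsto_mult_left[OF tendsto_norm]])
    moreover have "\<forall>\<^sub>F n in sequentially. \<bar>g (x + t *\<^sub>R d + h) - g (X n) - t * y\<bar> \<le> \<eta> * \<bar>t\<bar> + m * norm (h + (x - X n))"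
    proof -
      have "\<forall>\<^sub>F n in sequentially. norm (h + (x - X n)) < \<delta>"
        using order_tendstoD(2)[OF tendsto_norm[OF d1], of \<delta>] h by simp
      then show ?thesis
      proof eventually_elim
        case (elim n)
        then show ?case
          using approx_pointsD[OF X[rule_format, of n] t, of "h + (x - X n)"] by (simp add: algebra_simps)
      qed
    qed
    ultimately show "\<bar>g (x + t *\<^sub>R d + h) - g x - t * y\<bar> \<le> \<eta> * \<bar>t\<bar> + m * norm h"
      by (intro tendsto_le[OF sequentially_bot]) (simp_all only: add_0_right)
  qed
qed

lemma approx_points_mono:
  assumes "x \<in> approx_points g m d y \<eta> \<delta>" "m \<le> m'" "\<eta> + \<bar>y' - y\<bar> \<le> \<eta>'" "\<delta>' \<le> \<delta>"
  shows "x \<in> approx_points g m' d y' \<eta>' \<delta>'"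
  unfolding approx_points_def
proof (intro CollectI allI impI)
  fix t :: real and h :: 'a assume "\<bar>t\<bar> < \<delta>'" "norm h < \<delta>'"
  then have "\<bar>g (x + t *\<^sub>R d + h) - g x - t * y\<bar> \<le> \<eta> * \<bar>t\<bar> + m * norm h"
    using approx_pointsD[OF assms(1), of t h] assms(4) by simp
  moreover have "\<bar>t * y' - t * y\<bar> = \<bar>y' - y\<bar> * \<bar>t\<bar>"
    by (simp add: right_diff_distrib[symmetric] abs_mult)
  moreover have "(\<eta> + \<bar>y' - y\<bar>) * \<bar>t\<bar> \<le> \<eta>' * \<bar>t\<bar>" "m * norm h \<le> m' * norm h"
    using assms(2,3) by (auto intro: mult_right_mono)
  ultimately show "\<bar>g (x + t *\<^sub>R d + h) - g x - t * y'\<bar> \<le> \<eta>' * \<bar>t\<bar> + m' * norm h"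
    unfolding distrib_right by linarith
qed

text \<open>The change of direction is absorbed into the displacement \<open>h\<close>, at the price \<open>m * \<theta>\<close>.\<close>

lemma approx_points_direction:
  assumes "x \<in> approx_points g m d y \<eta> \<delta>" "0 \<le> m" "norm (d' - d) \<le> \<theta>" "\<theta> \<le> 1" "0 < \<delta>"
  shows "x \<in> approx_points g m d' y (\<eta> + m * \<theta>) (\<delta> / 2)"
  unfolding approx_points_def
proof (intro CollectI allI impI)
  fix t :: real and h :: 'a assume t: "\<bar>t\<bar> < \<delta> / 2" and h: "norm h < \<delta> / 2"
  let ?h = "t *\<^sub>R (d' - d) + h"
  have n: "norm ?h \<le> \<bar>t\<bar> * \<theta> + norm h"
    using norm_triangle_ineq[of "t *\<^sub>R (d' - d)" h] mult_left_mono[OF assms(3), of "\<bar>t\<bar>"] by simp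
  moreover have "\<bar>t\<bar> * \<theta> \<le> \<bar>t\<bar>" using assms(4) by (simp add: mult_left_le)
  ultimately have "\<bar>g (x + t *\<^sub>R d + ?h) - g x - t * y\<bar> \<le> \<eta> * \<bar>t\<bar> + m * norm ?h"
    using t h by (intro approx_pointsD[OF assms(1)]) auto
  also have "\<dots> \<le> \<eta> * \<bar>t\<bar> + m * (\<bar>t\<bar> * \<theta> + norm h)"
    using n assms(2) by (intro add_left_mono mult_left_mono)
  finally show "\<bar>g (x + t *\<^sub>R d' + h) - g x - t * y\<bar> \<le> (\<eta> + m * \<theta>) * \<bar>t\<bar> + m * norm h"
    by (simp add: algebra_simps)
qed

text \<open>Compare both approximations at the same point \<open>x + t d = x + t d' + t (d - d')\<close>.\<close>

lemma approx_points_slopes: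
  assumes "x \<in> approx_points g m d y \<eta> \<delta>" "x \<in> approx_points g m d' y' \<eta>' \<delta>'" "0 < \<delta>" "0 < \<delta>'" "0 \<le> m"
  shows "\<bar>y - y'\<bar> \<le> \<eta> + \<eta>' + m * norm (d - d')"
proof -
  define N where "N = 1 + norm (d - d')"
  have "0 < N" unfolding N_def using norm_ge_zero[of "d - d'"] by linarith
  define t where "t = min \<delta> \<delta>' / (2 * N)"
  have "0 < t" unfolding t_def using assms(3,4) \<open>0 < N\<close> by simp
  have "t * N = min \<delta> \<delta>' / 2"
    unfolding t_def using \<open>0 < N\<close> by simp
  then have "t + t * norm (d - d') = min \<delta> \<delta>' / 2" by (simp only: N_def distrib_left mult_1_right)
  moreover have "0 \<le> t * norm (d - d')" using \<open>0 < t\<close> by simp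
  moreover have "min \<delta> \<delta>' \<le> \<delta>" "min \<delta> \<delta>' \<le> \<delta>'" "0 < min \<delta> \<delta>'" using assms(3,4) by auto
  ultimately have t: "t < \<delta>" "t < \<delta>'" "t * norm (d - d') < \<delta>'"
    using \<open>0 < t\<close> by linarith+
  have "\<bar>g (x + t *\<^sub>R d + 0) - g x - t * y\<bar> \<le> \<eta> * \<bar>t\<bar> + m * norm (0::'a)"
    using t \<open>0 < t\<close> assms(3) by (intro approx_pointsD[OF assms(1)]) auto
  then have 1: "\<bar>g (x + t *\<^sub>R d) - g x - t * y\<bar> \<le> \<eta> * t" using \<open>0 < t\<close> by simp
  have "\<bar>g (x + t *\<^sub>R d' + t *\<^sub>R (d - d')) - g x - t * y'\<bar> \<le> \<eta>' * \<bar>t\<bar> + m * norm (t *\<^sub>R (d - d'))"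
    using t \<open>0 < t\<close> by (intro approx_pointsD[OF assms(2)]) auto
  moreover have "x + t *\<^sub>R d' + t *\<^sub>R (d - d') = x + t *\<^sub>R d" by (simp add: algebra_simps)
  ultimately have "\<bar>g (x + t *\<^sub>R d) - g x - t * y'\<bar> \<le> \<eta>' * t + m * (t * norm (d - d'))"
    using \<open>0 < t\<close> by simp
  with 1 have "\<bar>t * y - t * y'\<bar> \<le> \<eta> * t + (\<eta>' * t + m * (t * norm (d - d')))" by linarith
  also have "\<dots> = t * (\<eta> + \<eta>' + m * norm (d - d'))" by (simp add: algebra_simps)
  finally have "\<bar>t * y - t * y'\<bar> \<le> t * (\<eta> + \<eta>' + m * norm (d - d'))" .
  moreover have "\<bar>t * y - t * y'\<bar> = t * \<bar>y - y'\<bar>"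
    using \<open>0 < t\<close> by (simp add: right_diff_distrib[symmetric] abs_mult)
  ultimately show ?thesis using \<open>0 < t\<close> by simp
qed

definition has_direction_derivative :: "('a::real_normed_vector \<Rightarrow> real) \<Rightarrow> real \<Rightarrow> 'a \<Rightarrow> 'a \<Rightarrow> real \<Rightarrow> bool"
  where "has_direction_derivative g m x d y \<longleftrightarrow> (\<forall>\<eta>>0. \<exists>\<delta>>0. x \<in> approx_points g m d y \<eta> \<delta>)"

lemma direction_derivative_lipschitz:
  assumes "has_direction_derivative g m x d y" "has_direction_derivative g m x d' y'" "0 \<le> m"
  shows "\<bar>y - y'\<bar> \<le> m * norm (d - d')"
proof (rule field_le_epsilon)
  fix e :: real assume "0 < e"
  then obtain \<delta> \<delta>' where "0 < \<delta>" "x \<in> approx_points g m d y (e/2) \<delta>" "0 < \<delta>'" "x \<in> approx_points g m d' y' (e/2) \<delta>'"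
    using assms(1,2) unfolding has_direction_derivative_def by (meson half_gt_zero)
  from approx_points_slopes[OF this(2,4,1,3) assms(3)] show "\<bar>y - y'\<bar> \<le> m * norm (d - d') + e" by simp
qed

lemma approx_slope_close:
  assumes "has_direction_derivative g m x d y" "x \<in> approx_points g m d z \<eta> \<delta>" "0 < \<delta>" "0 \<le> m"
  shows "\<bar>z - y\<bar> \<le> \<eta>"
proof (rule field_le_epsilon)
  fix e :: real assume "0 < e"
  then obtain \<epsilon> where "0 < \<epsilon>" "x \<in> approx_points g m d y e \<epsilon>"
    using assms(1) unfolding has_direction_derivative_def by blast
  from approx_points_slopes[OF assms(2) this(2) assms(3) this(1) assms(4)] show "\<bar>z - y\<bar> \<le> \<eta> + e" by simp
qed

lemma direction_derivative_unique:
  assumes "has_direction_derivative g m x d y" "has_direction_derivative g m x d y'" "0 \<le> m"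
  shows "y = y'"
  using direction_derivative_lipschitz[OF assms] by simp

lemma direction_derivative_scale:
  assumes "has_direction_derivative g m x d y"
  shows "has_direction_derivative g m x (c *\<^sub>R d) (c * y)"
  unfolding has_direction_derivative_def
proof (intro allI impI)
  fix \<eta> :: real assume "0 < \<eta>"
  define b where "b = 1 + \<bar>c\<bar>"
  have b: "0 < b" "1 \<le> b" "\<bar>c\<bar> \<le> b" unfolding b_def by auto
  have "0 < \<eta> / b" using \<open>0 < \<eta>\<close> b(1) by simp
  then obtain \<delta> where \<delta>: "0 < \<delta>" "x \<in> approx_points g m d y (\<eta> / b) \<delta>"
    using assms unfolding has_direction_derivative_def by blast
  have "x \<in> approx_points g m (c *\<^sub>R d) (c * y) \<eta> (\<delta> / b)"
    unfolding approx_points_def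
  proof (intro CollectI allI impI)
    fix t :: real and h :: 'a assume t: "\<bar>t\<bar> < \<delta> / b" and h: "norm h < \<delta> / b"
    have tc: "\<bar>t * c\<bar> \<le> \<bar>t\<bar> * b" using b(3) by (simp add: abs_mult mult_left_mono)
    also have "\<bar>t\<bar> * b < \<delta>" using t b(1) by (simp add: pos_less_divide_eq)
    finally have "\<bar>t * c\<bar> < \<delta>" .
    moreover have "\<delta> / b \<le> \<delta>" using \<delta>(1) b(1,2) by (simp add: pos_divide_le_eq)
    ultimately have "\<bar>g (x + (t * c) *\<^sub>R d + h) - g x - t * c * y\<bar> \<le> \<eta> / b * \<bar>t * c\<bar> + m * norm h"
      using h by (intro approx_pointsD[OF \<delta>(2)]) auto
    also have "\<eta> / b * \<bar>t * c\<bar> \<le> \<eta> / b * (\<bar>t\<bar> * b)"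
      using tc \<open>0 < \<eta> / b\<close> by (intro mult_left_mono) auto
    also have "\<dots> = \<eta> * \<bar>t\<bar>" using b(1) by simp
    finally show "\<bar>g (x + t *\<^sub>R c *\<^sub>R d + h) - g x - t * (c * y)\<bar> \<le> \<eta> * \<bar>t\<bar> + m * norm h"
      by (simp add: mult.assoc)
  qed
  moreover have "0 < \<delta> / b" using \<delta>(1) b(1) by simp
  ultimately show "\<exists>\<delta>>0. x \<in> approx_points g m (c *\<^sub>R d) (c * y) \<eta> \<delta>" by blast
qed

text \<open>Approximate slopes for errors tending to \<open>0\<close> form a Cauchy sequence.\<close>

lemma direction_derivative_exists:
  assumes "0 \<le> m" and ex: "\<And>\<eta>. 0 < \<eta> \<Longrightarrow> \<exists>y. \<exists>\<delta>>0. x \<in> approx_points g m d y \<eta> \<delta>"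
  obtains y where "has_direction_derivative g m x d y"
proof -
  have "\<forall>n. \<exists>z \<delta>. 0 < \<delta> \<and> x \<in> approx_points g m d z (1 / real (Suc n)) \<delta>"
  proof
    fix n
    show "\<exists>z \<delta>. 0 < \<delta> \<and> x \<in> approx_points g m d z (1 / real (Suc n)) \<delta>"
      using ex[of "1 / real (Suc n)"] by simp
  qed
  then obtain z \<delta> where z: "\<And>n. 0 < \<delta> n" "\<And>n. x \<in> approx_points g m d (z n) (1 / real (Suc n)) (\<delta> n)"
    by metis
  have zz: "\<bar>z' - z n\<bar> \<le> \<eta> + 1 / real (Suc n)" if "x \<in> approx_points g m d z' \<eta> \<epsilon>" "0 < \<epsilon>" for n z' \<eta> \<epsilon>
    using approx_points_slopes[OF that(1) z(2) that(2) z(1) assms(1)] by simp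
  have "Cauchy z"
  proof (rule metric_CauchyI)
    fix e :: real assume "0 < e"
    then obtain N :: nat where N: "1 / Suc N < e / 2" using nat_approx_posE[of "e/2"] by auto
    have "dist (z i) (z j) < e" if "N \<le> i" "N \<le> j" for i j
    proof -
      have "1 / real (Suc i) \<le> 1 / Suc N" "1 / real (Suc j) \<le> 1 / Suc N"
        using that by (auto intro!: divide_left_mono)
      then show ?thesis using zz[OF z(2,1), of i j] N by (simp add: dist_real_def)
    qed
    then show "\<exists>N. \<forall>m\<ge>N. \<forall>n\<ge>N. dist (z m) (z n) < e" by blast
  qed
  then obtain y where y: "z \<longlonglongrightarrow> y" by (auto simp: Cauchy_convergent_iff convergent_def)
  have close: "\<bar>z' - y\<bar> \<le> \<eta>" if "x \<in> approx_points g m d z' \<eta> \<epsilon>" "0 < \<epsilon>" for z' \<eta> \<epsilon>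
  proof (rule tendsto_le[OF sequentially_bot])
    show "(\<lambda>n. \<eta> + 1 / real (Suc n)) \<longlonglongrightarrow> \<eta>"
      using tendsto_add[OF tendsto_const LIMSEQ_Suc[OF lim_1_over_n]] by auto
    show "(\<lambda>n. \<bar>z' - z n\<bar>) \<longlonglongrightarrow> \<bar>z' - y\<bar>" by (intro tendsto_intros y)
  qed (use zz[OF that] in auto)
  have "has_direction_derivative g m x d y"
    unfolding has_direction_derivative_def
  proof (intro allI impI)
    fix \<eta> :: real assume "0 < \<eta>"
    then obtain z' \<epsilon> where a: "0 < \<epsilon>" "x \<in> approx_points g m d z' (\<eta> / 2) \<epsilon>" using ex[of "\<eta> / 2"] by auto
    have "x \<in> approx_points g m d y \<eta> \<epsilon>"
      by (rule approx_points_mono[OF a(2)]) (use close[OF a(2,1)] in \<open>auto simp: abs_minus_commute\<close>)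
    with a(1) show "\<exists>\<delta>>0. x \<in> approx_points g m d y \<eta> \<delta>" by blast
  qed
  then show thesis by (rule that)
qed

definition robust_derivative :: "('a::real_normed_vector \<Rightarrow> real) \<Rightarrow> real \<Rightarrow> ('a \<Rightarrow> real) \<Rightarrow> 'a \<Rightarrow> bool"
  where "robust_derivative g m L x \<longleftrightarrow> bounded_linear L \<and> (\<forall>d. has_direction_derivative g m x d (L d))"

definition additive_approx :: "('a::real_normed_vector \<Rightarrow> real) \<Rightarrow> real \<Rightarrow> 'a \<Rightarrow> 'a \<Rightarrow> real \<Rightarrow> real \<Rightarrow> real \<Rightarrow> real \<Rightarrow> 'a set"
  where "additive_approx g m u v y z \<eta> \<delta> = approx_points g m u y \<eta> \<delta> \<inter> approx_points g m v z \<eta> \<delta> \<inter>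
    approx_points g m (u + v) (y + z) \<eta> \<delta>"

text \<open>The condition on approximate slopes passes from \<open>D\<close> to all directions because a small change of
  direction costs only \<open>m\<close> times its norm. The limits of the slopes are then additive.\<close>

lemma robust_derivativeI:
  assumes "0 \<le> m" "closure D = UNIV"
    and add: "\<And>u v \<eta>. \<lbrakk>u \<in> D; v \<in> D; 0 < \<eta>\<rbrakk> \<Longrightarrow> \<exists>y z. \<exists>\<delta>>0. x \<in> additive_approx g m u v y z \<eta> \<delta>"
  shows "\<exists>L. robust_derivative g m L x"
proof -
  have all: "\<exists>y z. \<exists>\<delta>>0. x \<in> additive_approx g m u v y z \<eta> \<delta>" if "0 < \<eta>" for u v \<eta>
  proof -
    define \<theta> where "\<theta> = min 1 (\<eta> / (2 * (1 + m)))"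
    have \<theta>: "0 < \<theta>" "\<theta> \<le> 1" unfolding \<theta>_def using that assms(1) by auto
    have "\<theta> * (1 + m) \<le> \<eta> / (2 * (1 + m)) * (1 + m)"
      unfolding \<theta>_def using assms(1) by (intro mult_right_mono) auto
    also have "\<dots> = \<eta> / 2" using add_pos_nonneg[OF zero_less_one assms(1)] by (simp del: distrib_left_numeral)
    finally have m\<theta>: "m * \<theta> \<le> \<eta> / 2" 
      using \<theta>(1) unfolding distrib_left mult.commute[of m] by linarith
    have "\<exists>w\<in>D. norm (d - w) \<le> \<theta> / 2" for d
    proof -
      have "d \<in> closure D" using assms(2) by simp
      then obtain w where "w \<in> D" "dist w d < \<theta> / 2"
        unfolding closure_approachable using \<theta>(1) half_gt_zero by blast
      then show ?thesis by (intro bexI[of _ w]) (auto simp: dist_norm norm_minus_commute)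
    qed
    then obtain u' v' where uv: "u' \<in> D" "v' \<in> D" "norm (u - u') \<le> \<theta> / 2" "norm (v - v') \<le> \<theta> / 2" by metis
    have "norm ((u + v) - (u' + v')) \<le> norm (u - u') + norm (v - v')"
      using norm_triangle_ineq[of "u - u'" "v - v'"] by (simp add: algebra_simps)
    then have uv': "norm ((u + v) - (u' + v')) \<le> \<theta>" using uv(3,4) by simp
    obtain y z \<delta> where "0 < \<delta>" and yz: "x \<in> additive_approx g m u' v' y z (\<eta> / 2) \<delta>"
      using add[OF uv(1,2), of "\<eta> / 2"] \<open>0 < \<eta>\<close> by auto
    have step: "x \<in> approx_points g m d' w \<eta> (\<delta> / 2)" if "x \<in> approx_points g m d w (\<eta> / 2) \<delta>" "norm (d' - d) \<le> \<theta>" for d d' w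
      by (rule approx_points_mono[OF approx_points_direction[OF that(1) assms(1) that(2) \<theta>(2) \<open>0 < \<delta>\<close>]])
        (use m\<theta> in auto)
    have "x \<in> additive_approx g m u v y z \<eta> (\<delta> / 2)"
      using yz uv(3,4) uv' \<theta>(1) unfolding additive_approx_def by (auto intro: step)
    then show ?thesis using \<open>0 < \<delta>\<close> by (metis half_gt_zero)
  qed
  have "\<exists>y. has_direction_derivative g m x d y" for d
  proof -
    have "\<exists>y. \<exists>\<delta>>0. x \<in> approx_points g m d y \<eta> \<delta>" if "0 < \<eta>" for \<eta>
      using all[OF that, of d d] unfolding additive_approx_def by auto
    then obtain y where "has_direction_derivative g m x d y"
      by (rule direction_derivative_exists[OF assms(1)])
    then show ?thesis ..
  qed
  then obtain L where L: "\<And>d. has_direction_derivative g m x d (L d)" by metis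
  have "L (u + v) = L u + L v" for u v
  proof -
    have "\<bar>L (u + v) - (L u + L v)\<bar> \<le> 0 + e" if "0 < e" for e
    proof -
      obtain y z \<delta> where "0 < \<delta>" "x \<in> additive_approx g m u v y z (e / 3) \<delta>" using all[of "e / 3" u v] \<open>0 < e\<close> by auto
      then have "\<bar>y - L u\<bar> \<le> e / 3" "\<bar>z - L v\<bar> \<le> e / 3" "\<bar>(y + z) - L (u + v)\<bar> \<le> e / 3"
        unfolding additive_approx_def using approx_slope_close[OF L _ _ assms(1)] by blast+
      then show ?thesis by linarith
    qed
    from field_le_epsilon[OF this] show ?thesis by simp
  qed
  moreover have "L (c *\<^sub>R d) = c * L d" for c d
    by (rule direction_derivative_unique[OF L direction_derivative_scale[OF L] assms(1)])
  moreover have "norm (L d) \<le> norm d * m" for d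
    using direction_derivative_lipschitz[OF L direction_derivative_scale[OF L, of 0], of d d] assms(1) by (simp add: mult.commute)
  ultimately have "bounded_linear L" by (intro bounded_linear_intro[of L m]) auto
  then show ?thesis unfolding robust_derivative_def using L by blast
qed

lemma additive_approx_mono:
  assumes "x \<in> additive_approx g m u v y z \<eta> \<delta>" "m \<le> m'" "\<eta> + \<bar>y' - y\<bar> + \<bar>z' - z\<bar> \<le> \<eta>'" "\<delta>' \<le> \<delta>"
  shows "x \<in> additive_approx g m' u v y' z' \<eta>' \<delta>'"
proof -
  have x: "x \<in> approx_points g m u y \<eta> \<delta>" "x \<in> approx_points g m v z \<eta> \<delta>" "x \<in> approx_points g m (u + v) (y + z) \<eta> \<delta>"
    using assms(1) unfolding additive_approx_def by auto
  have "x \<in> approx_points g m' u y' \<eta>' \<delta>'"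
    by (rule approx_points_mono[OF x(1)]) (use assms(2-4) in linarith)+
  moreover have "x \<in> approx_points g m' v z' \<eta>' \<delta>'"
    by (rule approx_points_mono[OF x(2)]) (use assms(2-4) in linarith)+
  moreover have "x \<in> approx_points g m' (u + v) (y' + z') \<eta>' \<delta>'"
    by (rule approx_points_mono[OF x(3)]) (use assms(2-4) in linarith)+
  ultimately show ?thesis unfolding additive_approx_def by simp
qed

lemma robust_derivative_additive_approx:
  assumes "robust_derivative g m L x" "0 < \<eta>"
  shows "\<exists>\<delta>>0. x \<in> additive_approx g m u v (L u) (L v) \<eta> \<delta>"
proof -
  interpret bounded_linear L using assms(1) unfolding robust_derivative_def by simp
  have "\<exists>\<delta>>0. x \<in> approx_points g m d (L d) \<eta> \<delta>" for d
    using assms unfolding robust_derivative_def has_direction_derivative_def by blast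
  then obtain r where r: "\<And>d. 0 < r d" "\<And>d. x \<in> approx_points g m d (L d) \<eta> (r d)" by metis
  let ?\<delta> = "min (r u) (min (r v) (r (u + v)))"
  have "x \<in> approx_points g m d (L d) \<eta> ?\<delta>" if "d \<in> {u, v, u + v}" for d
    by (rule approx_points_mono[OF r(2)]) (use that in auto)
  then have "x \<in> additive_approx g m u v (L u) (L v) \<eta> ?\<delta>"
    unfolding additive_approx_def add[symmetric] by simp
  then show ?thesis using r(1) by (intro exI[of _ ?\<delta>]) simp
qed

text \<open>By \<open>robust_derivativeI\<close> the derivative can be recognised from countably many directions, rational slopes
  and reciprocals of integers, that is from countably many of the closed sets \<open>approx_points\<close>.\<close>

lemma robust_points_borel:
  fixes g :: "'a::real_normed_vector \<Rightarrow> real"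
  assumes "countable D" "closure D = (UNIV :: 'a set)" "0 \<le> m"
  shows "{x. \<exists>L. robust_derivative g m L x} \<in> sets borel"
proof -
  let ?B = "\<Inter>u\<in>D. \<Inter>v\<in>D. \<Inter>n::nat. \<Union>y\<in>\<rat>. \<Union>z\<in>\<rat>. \<Union>k::nat. additive_approx g m u v y z (1 / real (Suc n)) (1 / real (Suc k))"
  have "closed (additive_approx g m u v y z \<eta> \<delta>)" for u v y z \<eta> \<delta>
    unfolding additive_approx_def by (intro closed_Int closed_approx_points)
  then have "?B \<in> sets borel"
    using assms(1) countable_rat
    by (intro sets.countable_INT'' sets.countable_UN'' sets.countable_INT sets.countable_UN) (auto intro: borel_closed)
  moreover have "{x. \<exists>L. robust_derivative g m L x} = ?B"
  proof (intro equalityI subsetI)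
    fix x assume "x \<in> {x. \<exists>L. robust_derivative g m L x}"
    then obtain L where L: "robust_derivative g m L x" by blast
    have "\<exists>y\<in>\<rat>. \<exists>z\<in>\<rat>. \<exists>k::nat. x \<in> additive_approx g m u v y z (1 / real (Suc n)) (1 / real (Suc k))" for u v n
    proof -
      define e where "e = 1 / real (Suc n)"
      have e: "0 < e" unfolding e_def by simp
      obtain \<delta> where \<delta>: "0 < \<delta>" "x \<in> additive_approx g m u v (L u) (L v) (e / 3) \<delta>"
        using robust_derivative_additive_approx[OF L, of "e / 3" u v] e by auto
      obtain y z where y: "y \<in> \<rat>" "L u < y" "y < L u + e / 3" and z: "z \<in> \<rat>" "L v < z" "z < L v + e / 3"
        using Rats_dense_in_real[of "L u" "L u + e / 3"] Rats_dense_in_real[of "L v" "L v + e / 3"] e by auto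
      obtain k :: nat where k: "1 / Suc k < \<delta>" using nat_approx_posE[OF \<delta>(1)] by auto
      have "x \<in> additive_approx g m u v y z e (1 / real (Suc k))"
        by (rule additive_approx_mono[OF \<delta>(2)]) (use y z k in linarith)+
      with y(1) z(1) show ?thesis unfolding e_def by (intro bexI[of _ y] bexI[of _ z] exI[of _ k])
    qed
    then show "x \<in> ?B" by (simp only: INT_iff UN_iff) simp
  next
    fix x assume x: "x \<in> ?B"
    show "x \<in> {x. \<exists>L. robust_derivative g m L x}"
    proof (intro CollectI robust_derivativeI[OF assms(3,2)])
      fix u v and \<eta> :: real assume uv: "u \<in> D" "v \<in> D" and "0 < \<eta>"
      obtain n :: nat where n: "1 / Suc n < \<eta>" using nat_approx_posE[OF \<open>0 < \<eta>\<close>] by auto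
      obtain y z and k :: nat where "x \<in> additive_approx g m u v y z (1 / real (Suc n)) (1 / real (Suc k))"
        using x uv by (simp only: INT_iff UN_iff) blast
      then have "x \<in> additive_approx g m u v y z \<eta> (1 / real (Suc k))"
        by (rule additive_approx_mono) (use n in auto)
      then show "\<exists>y z. \<exists>\<delta>>0. x \<in> additive_approx g m u v y z \<eta> \<delta>"
        by (intro exI[of _ y] exI[of _ z] exI[of _ "1 / real (Suc k)"]) simp
    qed
  qed
  ultimately show ?thesis by simp
qed

text \<open>A compact set of directions is covered by finitely many small balls, and the approximation at the
  centre of a ball serves all directions in it.\<close>

lemma robust_derivative_hadamard:
  assumes "robust_derivative g m L x" "0 \<le> m"
  shows "hadamard_differentiable_at g x"
proof -
  have bl: "bounded_linear L" and L: "\<And>d. has_direction_derivative g m x d (L d)"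
    using assms(1) unfolding robust_derivative_def by auto
  have Lapp: "blinfun_apply (Blinfun L) = L" using bl by (simp add: bounded_linear_Blinfun_apply)
  have unif: "uniform_limit K (\<lambda>t h. (g (x + t *\<^sub>R h) - g x) / t) L (at 0)" if cpt: "compact K" for K
  proof (rule uniform_limitI)
    fix e :: real assume "0 < e"
    define \<epsilon> where "\<epsilon> = e / (4 * (1 + m))"
    have "0 < \<epsilon>" unfolding \<epsilon>_def using \<open>0 < e\<close> assms(2) by simp
    have "\<epsilon> * (1 + m) = e / 4"
      unfolding \<epsilon>_def using add_pos_nonneg[OF zero_less_one assms(2)] by (simp del: distrib_left_numeral)
    then have \<epsilon>: "\<epsilon> + 2 * (m * \<epsilon>) < e" "0 \<le> m * \<epsilon>" using \<open>0 < e\<close> \<open>0 < \<epsilon>\<close> assms(2) by (auto simp: algebra_simps)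
    have "\<exists>\<delta>>0. x \<in> approx_points g m d (L d) \<epsilon> \<delta>" for d
      using L \<open>0 < \<epsilon>\<close> unfolding has_direction_derivative_def by blast
    then obtain r where r: "\<And>d. 0 < r d" "\<And>d. x \<in> approx_points g m d (L d) \<epsilon> (r d)" by metis
    obtain C where C: "C \<subseteq> K" "finite C" "K \<subseteq> (\<Union>d\<in>C. ball d \<epsilon>)"
    proof (rule compactE_image[OF cpt, of K "\<lambda>d. ball d \<epsilon>"])
      show "K \<subseteq> (\<Union>d\<in>K. ball d \<epsilon>)" using \<open>0 < \<epsilon>\<close> by auto
    qed auto
    have "\<forall>\<^sub>F t in at (0::real). \<forall>d\<in>C. \<bar>t\<bar> < r d \<and> \<bar>t\<bar> * \<epsilon> < r d \<and> t \<noteq> 0"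
    proof (intro eventually_ball_finite C(2) ballI)
      fix d assume "d \<in> C"
      have "0 < min (r d) (r d / \<epsilon>)" using r(1) \<open>0 < \<epsilon>\<close> by simp
      then show "\<forall>\<^sub>F t in at (0::real). \<bar>t\<bar> < r d \<and> \<bar>t\<bar> * \<epsilon> < r d \<and> t \<noteq> 0"
        unfolding eventually_at using \<open>0 < \<epsilon>\<close>
        by (intro exI[of _ "min (r d) (r d / \<epsilon>)"]) (auto simp: dist_real_def field_simps)
    qed
    then show "\<forall>\<^sub>F t in at 0. \<forall>h\<in>K. dist ((g (x + t *\<^sub>R h) - g x) / t) (L h) < e"
    proof eventually_elim
      case (elim t)
      show ?case
      proof
        fix h assume "h \<in> K"
        then obtain d where d: "d \<in> C" "dist d h < \<epsilon>" using C(3) by auto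
        then have t: "\<bar>t\<bar> < r d" "\<bar>t\<bar> * \<epsilon> < r d" "t \<noteq> 0" using elim by auto
        have n: "norm (h - d) \<le> \<epsilon>" using d(2) by (simp add: dist_norm norm_minus_commute)
        then have nt: "norm (t *\<^sub>R (h - d)) \<le> \<bar>t\<bar> * \<epsilon>" by (simp add: mult_left_mono)
        have "\<bar>g (x + t *\<^sub>R d + t *\<^sub>R (h - d)) - g x - t * L d\<bar> \<le> \<epsilon> * \<bar>t\<bar> + m * norm (t *\<^sub>R (h - d))"
          by (intro approx_pointsD[OF r(2)] t(1) order.strict_trans1[OF nt t(2)])
        also have "m * norm (t *\<^sub>R (h - d)) \<le> m * \<epsilon> * \<bar>t\<bar>"
          using mult_left_mono[OF nt assms(2)] by (simp only: mult_ac)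
        finally have "\<bar>g (x + t *\<^sub>R h) - g x - t * L d\<bar> \<le> (\<epsilon> + m * \<epsilon>) * \<bar>t\<bar>"
          by (simp add: algebra_simps)
        moreover have "(g (x + t *\<^sub>R h) - g x) / t - L d = (g (x + t *\<^sub>R h) - g x - t * L d) / t"
          using t(3) by (simp add: field_simps)
        ultimately have "\<bar>(g (x + t *\<^sub>R h) - g x) / t - L d\<bar> \<le> \<epsilon> + m * \<epsilon>"
          using t(3) by (simp add: abs_divide pos_divide_le_eq)
        moreover have "\<bar>L h - L d\<bar> \<le> m * \<epsilon>"
          using direction_derivative_lipschitz[OF L L assms(2), of h d] mult_left_mono[OF n assms(2)] by simp
        ultimately show "dist ((g (x + t *\<^sub>R h) - g x) / t) (L h) < e"
          unfolding dist_real_def using \<epsilon>(1) by linarith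
      qed
    qed
  qed
  have "has_gateaux_derivative g (Blinfun L) x"
    unfolding has_gateaux_derivative_def Lapp
    using tendsto_uniform_limitI[OF unif[of "{_}"]] by auto
  then show ?thesis
    unfolding hadamard_differentiable_at_def using unif Lapp by (intro exI[of _ "Blinfun L"]) simp
qed

section \<open>Robust derivatives at Lipschitz points\<close>

definition differentiable_on_lines :: "('a::real_normed_vector \<Rightarrow> real) \<Rightarrow> bool"
  where "differentiable_on_lines g \<longleftrightarrow> (\<forall>x v. negligible {t. \<not> (\<lambda>s. g (x + s *\<^sub>R v)) differentiable (at t)})"

definition lipschitz_points :: "('a::real_normed_vector \<Rightarrow> real) \<Rightarrow> real \<Rightarrow> real \<Rightarrow> 'a set"
  where "lipschitz_points g m \<delta> = approx_points g m 0 0 0 \<delta>"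

lemma lipschitz_points_iff:
  "0 < \<delta> \<Longrightarrow> x \<in> lipschitz_points g m \<delta> \<longleftrightarrow> (\<forall>h. norm h < \<delta> \<longrightarrow> \<bar>g (x + h) - g x\<bar> \<le> m * norm h)"
  unfolding lipschitz_points_def approx_points_def by (auto intro: exI[of _ 0])

lemma two_sided_not_porousE:
  assumes "x \<in> A" "x \<notin> porous_points v c A" "x \<notin> porous_points (- v) c A"
  obtains \<delta> where "0 < \<delta>" "\<And>t. t \<noteq> 0 \<Longrightarrow> \<bar>t\<bar> < \<delta> \<Longrightarrow> \<exists>a\<in>A. norm (x + t *\<^sub>R v - a) < c * \<bar>t\<bar>"
proof -
  obtain \<delta>1 where 1: "0 < \<delta>1" "\<And>t. 0 < t \<Longrightarrow> t < \<delta>1 \<Longrightarrow> \<exists>a\<in>A. norm (a - (x + t *\<^sub>R v)) < c * t"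
    using not_porousE[OF assms(1,2)] by blast
  obtain \<delta>2 where 2: "0 < \<delta>2" "\<And>t. 0 < t \<Longrightarrow> t < \<delta>2 \<Longrightarrow> \<exists>a\<in>A. norm (a - (x + t *\<^sub>R - v)) < c * t"
    using not_porousE[OF assms(1,3)] by blast
  have "\<exists>a\<in>A. norm (x + t *\<^sub>R v - a) < c * \<bar>t\<bar>" if "t \<noteq> 0" "\<bar>t\<bar> < min \<delta>1 \<delta>2" for t
  proof (cases "0 < t")
    case True
    then show ?thesis using 1(2)[of t] that by (simp add: norm_minus_commute)
  next
    case False
    then show ?thesis using 2(2)[of "- t"] that by (simp add: norm_minus_commute)
  qed
  then show thesis using that[of "min \<delta>1 \<delta>2"] 1(1) 2(1) by simp
qed

text \<open>Near every point \<open>x + t v\<close> of the line there is a point \<open>a\<close> at which \<open>g\<close> is Lipschitz with the constant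
  \<open>m\<close>, at a distance small compared with \<open>t\<close>. Hence \<open>g (x + t v + h)\<close> differs from \<open>g (x + t v)\<close> by
  little more than \<open>m * norm h\<close>, and the derivative along the line controls all nearby points.\<close>

lemma line_derivative_imp_direction_derivative:
  assumes "0 \<le> m" "0 < \<delta>" and x: "x \<in> lipschitz_points g m \<delta>"
    and np: "\<And>j::nat. x \<notin> porous_points v (1 / real (Suc j)) (lipschitz_points g m \<delta>)"
      "\<And>j::nat. x \<notin> porous_points (- v) (1 / real (Suc j)) (lipschitz_points g m \<delta>)"
    and "(\<lambda>s. g (x + s *\<^sub>R v)) differentiable (at 0)"
  shows "\<exists>y. has_direction_derivative g m x v y"
proof -
  obtain y where "((\<lambda>s. g (x + s *\<^sub>R v)) has_real_derivative y) (at 0)"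
    using assms(6) by (auto simp: real_differentiable_def)
  then have lim: "(\<lambda>h. (g (x + h *\<^sub>R v) - g x) / h) \<midarrow>0\<rightarrow> y" by (simp add: DERIV_def)
  have "has_direction_derivative g m x v y"
    unfolding has_direction_derivative_def
  proof (intro allI impI)
    fix \<eta> :: real assume "0 < \<eta>"
    \<comment> \<open>The error consists of \<open>\<eta> / 2\<close> along the line and of \<open>2 * m * c\<close> for two displacements of size \<open>c * t\<close>.\<close>
    then have "0 < \<eta> / (4 * (1 + m))" using assms(1) by simp
    then obtain j :: nat where "1 / Suc j < \<eta> / (4 * (1 + m))" using nat_approx_posE by blast
    moreover define c where "c = 1 / real (Suc j)"
    ultimately have "c * (4 * (1 + m)) < \<eta>" using assms(1) by (simp add: pos_less_divide_eq del: distrib_left_numeral)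
    moreover have c: "0 < c" "c \<le> 1" unfolding c_def by auto
    ultimately have mc: "2 * (m * c) \<le> \<eta> / 2" by (simp add: algebra_simps)
    obtain \<delta>1 where \<delta>1: "0 < \<delta>1" "\<And>h. h \<noteq> 0 \<Longrightarrow> \<bar>h\<bar> < \<delta>1 \<Longrightarrow> \<bar>(g (x + h *\<^sub>R v) - g x) / h - y\<bar> < \<eta> / 2"
      using tendstoD[OF lim, of "\<eta> / 2"] \<open>0 < \<eta>\<close> by (auto simp: eventually_at dist_real_def)
    obtain \<delta>2 where \<delta>2: "0 < \<delta>2" "\<And>t. t \<noteq> 0 \<Longrightarrow> \<bar>t\<bar> < \<delta>2 \<Longrightarrow> \<exists>a\<in>lipschitz_points g m \<delta>. norm (x + t *\<^sub>R v - a) < c * \<bar>t\<bar>"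
      by (rule two_sided_not_porousE[OF x np(1)[of j, folded c_def] np(2)[of j, folded c_def]]) blast
    have "x \<in> approx_points g m v y \<eta> (min (min \<delta>1 \<delta>2) (\<delta> / 2))"
      unfolding approx_points_def
    proof (intro CollectI allI impI)
      fix t :: real and h :: 'a assume t: "\<bar>t\<bar> < min (min \<delta>1 \<delta>2) (\<delta> / 2)" and h: "norm h < min (min \<delta>1 \<delta>2) (\<delta> / 2)"
      show "\<bar>g (x + t *\<^sub>R v + h) - g x - t * y\<bar> \<le> \<eta> * \<bar>t\<bar> + m * norm h"
      proof (cases "t = 0")
        case True
        have "\<bar>g (x + h) - g x\<bar> \<le> m * norm h"
          using x h assms(2) by (simp add: lipschitz_points_iff)
        then show ?thesis using True by simp
      next
        case False
        then obtain a where a: "a \<in> lipschitz_points g m \<delta>" "norm (x + t *\<^sub>R v - a) < c * \<bar>t\<bar>" using \<delta>2(2) t by auto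
        define k where "k = x + t *\<^sub>R v - a"
        have ct: "c * \<bar>t\<bar> \<le> \<bar>t\<bar>" using c by (simp add: mult_left_le_one_le)
        have k: "norm k < c * \<bar>t\<bar>" "a + k = x + t *\<^sub>R v" using a(2) unfolding k_def by auto
        have hk: "norm (k + h) \<le> norm k + norm h" by (rule norm_triangle_ineq)
        have "norm k < \<delta>" "norm (k + h) < \<delta>" using hk k(1) ct t h assms(2) by linarith+
        then have "\<bar>g (a + k) - g a\<bar> \<le> m * norm k" "\<bar>g (a + (k + h)) - g a\<bar> \<le> m * norm (k + h)"
          using a(1) assms(2) by (auto simp: lipschitz_points_iff)
        moreover have ak: "a + (k + h) = x + t *\<^sub>R v + h" using k(2) by (simp add: add.assoc[symmetric])
        moreover have "m * norm (k + h) \<le> m * (norm k + norm h)" using hk assms(1) by (rule mult_left_mono)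
        moreover have "m * norm k \<le> m * (c * \<bar>t\<bar>)" using k(1) assms(1) by (intro mult_left_mono) auto
        ultimately have 1: "\<bar>g (x + t *\<^sub>R v + h) - g (x + t *\<^sub>R v)\<bar> \<le> 2 * (m * (c * \<bar>t\<bar>)) + m * norm h"
          unfolding k(2) ak distrib_left by linarith
        have "\<bar>(g (x + t *\<^sub>R v) - g x - t * y) / t\<bar> < \<eta> / 2"
          using \<delta>1(2)[OF False] t False by (simp add: diff_divide_distrib)
        then have 2: "\<bar>g (x + t *\<^sub>R v) - g x - t * y\<bar> \<le> \<eta> / 2 * \<bar>t\<bar>"
          using False by (simp add: abs_divide pos_divide_less_eq)
        have "2 * (m * (c * \<bar>t\<bar>)) = 2 * (m * c) * \<bar>t\<bar>" by simp
        also have "\<dots> \<le> \<eta> / 2 * \<bar>t\<bar>" using mc by (intro mult_right_mono) auto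
        finally show ?thesis using 1 2 by linarith
      qed
    qed
    then show "\<exists>\<delta>>0. x \<in> approx_points g m v y \<eta> \<delta>" using \<delta>1(1) \<delta>2(1) assms(2)
      by (intro exI[of _ "min (min \<delta>1 \<delta>2) (\<delta> / 2)"]) simp
  qed
  then show ?thesis by blast
qed

text \<open>Go from \<open>x\<close> in direction \<open>u\<close>; close to \<open>x + t u\<close> there is a point \<open>a\<close> of \<open>A\<close>, from which one continues in
  direction \<open>v\<close>. The two displacements that replace \<open>x + t u\<close> by \<open>a\<close> cost \<open>m * c * t\<close> each.\<close>

lemma approx_points_add:
  assumes "0 \<le> m" "0 < \<delta>" "0 < c" "c \<le> 1"
    and A: "A = approx_points g m u y \<eta> \<delta> \<inter> approx_points g m v z \<eta> \<delta>" and x: "x \<in> A"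
    and np: "x \<notin> porous_points u c A" "x \<notin> porous_points (- u) c A"
  shows "\<exists>\<delta>>0. x \<in> approx_points g m (u + v) (y + z) (2 * \<eta> + 2 * (m * c)) \<delta>"
proof -
  obtain \<delta>2 where \<delta>2: "0 < \<delta>2" "\<And>t. t \<noteq> 0 \<Longrightarrow> \<bar>t\<bar> < \<delta>2 \<Longrightarrow> \<exists>a\<in>A. norm (x + t *\<^sub>R u - a) < c * \<bar>t\<bar>"
    by (rule two_sided_not_porousE[OF x np]) blast
  have xA: "x \<in> approx_points g m u y \<eta> \<delta>" using x A by simp
  have "x \<in> approx_points g m (u + v) (y + z) (2 * \<eta> + 2 * (m * c)) (min \<delta>2 (\<delta> / 2))"
    unfolding approx_points_def
  proof (intro CollectI allI impI)
    fix t :: real and h :: 'a assume t: "\<bar>t\<bar> < min \<delta>2 (\<delta> / 2)" and h: "norm h < min \<delta>2 (\<delta> / 2)"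
    show "\<bar>g (x + t *\<^sub>R (u + v) + h) - g x - t * (y + z)\<bar> \<le> (2 * \<eta> + 2 * (m * c)) * \<bar>t\<bar> + m * norm h"
    proof (cases "t = 0")
      case True
      then show ?thesis using approx_points_lipschitz[OF xA, of h] h assms(2) by simp
    next
      case False
      then obtain a where a: "a \<in> A" "norm (x + t *\<^sub>R u - a) < c * \<bar>t\<bar>" using \<delta>2(2) t by auto
      define k where "k = x + t *\<^sub>R u - a"
      have ct: "c * \<bar>t\<bar> \<le> \<bar>t\<bar>" using assms(3,4) by (simp add: mult_left_le_one_le)
      have k: "norm k < c * \<bar>t\<bar>" using a(2) unfolding k_def by auto
      have hk: "norm (h + k) \<le> norm h + norm k" by (rule norm_triangle_ineq)
      have "\<bar>t\<bar> < \<delta>" "norm (- k) < \<delta>" "norm (h + k) < \<delta>" using hk k ct t h assms(2) unfolding norm_minus_cancel by linarith+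
      moreover have aA: "a \<in> approx_points g m v z \<eta> \<delta>" using a(1) A by simp
      ultimately have "\<bar>g (x + t *\<^sub>R u + - k) - g x - t * y\<bar> \<le> \<eta> * \<bar>t\<bar> + m * norm (- k)"
        "\<bar>g (a + t *\<^sub>R v + (h + k)) - g a - t * z\<bar> \<le> \<eta> * \<bar>t\<bar> + m * norm (h + k)"
        by (blast intro: approx_pointsD[OF xA] approx_pointsD[OF aA])+
      moreover have eq: "x + t *\<^sub>R u + - k = a" "a + t *\<^sub>R v + (h + k) = x + t *\<^sub>R (u + v) + h"
        unfolding k_def by (auto simp: algebra_simps)
      moreover have "m * norm (h + k) \<le> m * (norm h + norm k)" using hk assms(1) by (rule mult_left_mono)
      moreover have "m * norm k \<le> m * (c * \<bar>t\<bar>)" using k assms(1) by (intro mult_left_mono) auto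
      ultimately have "\<bar>g (x + t *\<^sub>R (u + v) + h) - g x - (t * y + t * z)\<bar> \<le> 2 * (\<eta> * \<bar>t\<bar>) + 2 * (m * (c * \<bar>t\<bar>)) + m * norm h"
        unfolding eq distrib_left norm_minus_cancel by linarith
      then show ?thesis by (simp add: algebra_simps)
    qed
  qed
  then show ?thesis using \<delta>2(1) assms(2) by (intro exI[of _ "min \<delta>2 (\<delta> / 2)"]) simp
qed

lemma null_cover_not_additive:
  assumes "closure (span (range \<xi>)) = UNIV" "0 \<le> m"
  shows "null_cover \<xi> {x. \<exists>y z. has_direction_derivative g m x u y \<and> has_direction_derivative g m x v z \<and>
    \<not> has_direction_derivative g m x (u + v) (y + z)}" (is "null_cover \<xi> ?N")
proof -
  define A where "A y z j k = approx_points g m u y (1 / real (Suc j)) (1 / real (Suc k)) \<inter>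
    approx_points g m v z (1 / real (Suc j)) (1 / real (Suc k))" for y z and j k :: nat
  let ?P = "\<Union>y\<in>\<rat>. \<Union>z\<in>\<rat>. \<Union>j. \<Union>k. porous_points u (1 / real (Suc j)) (A y z j k) \<union> porous_points (- u) (1 / real (Suc j)) (A y z j k)"
  have "?N \<subseteq> ?P"
  proof
    fix x assume "x \<in> ?N"
    then obtain y z where yz: "has_direction_derivative g m x u y" "has_direction_derivative g m x v z"
      and not: "\<not> has_direction_derivative g m x (u + v) (y + z)" by blast
    show "x \<in> ?P"
    proof (rule ccontr)
      assume nP: "x \<notin> ?P"
      have "has_direction_derivative g m x (u + v) (y + z)"
        unfolding has_direction_derivative_def
      proof (intro allI impI)
        fix \<eta> :: real assume "0 < \<eta>"
        \<comment> \<open>\<open>2 * e + 2 * m * e\<close> comes from \<open>approx_points_add\<close>, another \<open>e\<close> from rounding the two slopes.\<close>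
        then have "0 < \<eta> / (3 + 2 * m)" using assms(2) by simp
        then obtain j :: nat where j: "1 / Suc j < \<eta> / (3 + 2 * m)" using nat_approx_posE by blast
        define e where "e = 1 / real (Suc j)"
        have e: "0 < e" "e \<le> 1" unfolding e_def by auto
        have "e * (3 + 2 * m) < \<eta>" using j assms(2) unfolding e_def[symmetric] by (simp add: pos_less_divide_eq)
        then have e\<eta>: "2 * e + 2 * (m * e) + e \<le> \<eta>" by (simp add: algebra_simps)
        obtain \<delta>1 \<delta>2 where d: "0 < \<delta>1" "x \<in> approx_points g m u y (e / 2) \<delta>1" "0 < \<delta>2" "x \<in> approx_points g m v z (e / 2) \<delta>2"
          using yz e(1) unfolding has_direction_derivative_def by (meson half_gt_zero)
        obtain k :: nat where "1 / Suc k < min \<delta>1 \<delta>2" using nat_approx_posE[of "min \<delta>1 \<delta>2"] d(1,3) by auto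
        then have k: "1 / real (Suc k) \<le> \<delta>1" "1 / real (Suc k) \<le> \<delta>2" by auto
        obtain y' where y': "y' \<in> \<rat>" "y < y'" "y' < y + e / 2" using Rats_dense_in_real[of y "y + e / 2"] e(1) by auto
        obtain z' where z': "z' \<in> \<rat>" "z < z'" "z' < z + e / 2" using Rats_dense_in_real[of z "z + e / 2"] e(1) by auto
        have "x \<in> approx_points g m u y' e (1 / real (Suc k))"
          by (rule approx_points_mono[OF d(2) order_refl _ k(1)]) (use y' in linarith)
        moreover have "x \<in> approx_points g m v z' e (1 / real (Suc k))"
          by (rule approx_points_mono[OF d(4) order_refl _ k(2)]) (use z' in linarith)
        ultimately have xA: "x \<in> A y' z' j k" unfolding A_def e_def by simp
        have "x \<notin> porous_points u e (A y' z' j k)" "x \<notin> porous_points (- u) e (A y' z' j k)"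
          using nP y'(1) z'(1) unfolding e_def by blast+
        from approx_points_add[OF assms(2) _ e A_def[of y' z' j k, folded e_def] xA this]
        obtain \<delta> where \<delta>: "0 < \<delta>" "x \<in> approx_points g m (u + v) (y' + z') (2 * e + 2 * (m * e)) \<delta>" by auto
        have "x \<in> approx_points g m (u + v) (y + z) \<eta> \<delta>"
          by (rule approx_points_mono[OF \<delta>(2) order_refl _ order_refl]) (use y' z' e\<eta> in linarith)
        then show "\<exists>\<delta>>0. x \<in> approx_points g m (u + v) (y + z) \<eta> \<delta>" using \<delta>(1) by blast
      qed
      with not show False by simp
    qed
  qed
  moreover have "null_cover \<xi> ?P"
    by (intro null_cover_UN null_cover_UN_nat null_cover_Un null_cover_porous[OF assms(1)] countable_rat) simp_all
  ultimately show ?thesis using null_cover_subset by blast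
qed

lemma direction_derivative_borel:
  assumes "0 \<le> m"
  shows "{x. \<exists>y. has_direction_derivative g m x d y} \<in> sets borel"
proof -
  let ?B = "\<Inter>j::nat. \<Union>y\<in>\<rat>. \<Union>k::nat. approx_points g m d y (1 / real (Suc j)) (1 / real (Suc k))"
  have "{x. \<exists>y. has_direction_derivative g m x d y} = ?B"
  proof (intro equalityI subsetI)
    fix x assume "x \<in> {x. \<exists>y. has_direction_derivative g m x d y}"
    then obtain y where y: "has_direction_derivative g m x d y" by blast
    have "\<exists>y\<in>\<rat>. \<exists>k::nat. x \<in> approx_points g m d y (1 / real (Suc j)) (1 / real (Suc k))" for j :: nat
    proof -
      define e where "e = 1 / real (Suc j)"
      have e: "0 < e" unfolding e_def by simp
      then obtain \<delta> where \<delta>: "0 < \<delta>" "x \<in> approx_points g m d y (e / 2) \<delta>"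
        using y unfolding has_direction_derivative_def by (meson half_gt_zero)
      obtain k :: nat where k: "1 / Suc k < \<delta>" using nat_approx_posE[OF \<delta>(1)] by auto
      obtain y' where y': "y' \<in> \<rat>" "y < y'" "y' < y + e / 2" using Rats_dense_in_real[of y "y + e / 2"] e(1) by auto
      have "x \<in> approx_points g m d y' e (1 / real (Suc k))"
        by (rule approx_points_mono[OF \<delta>(2) order_refl]) (use y' k in linarith)+
      then show ?thesis using y'(1) unfolding e_def by (intro bexI[of _ y'] exI[of _ k])
    qed
    then show "x \<in> ?B" by (simp only: INT_iff UN_iff) simp
  next
    fix x assume x: "x \<in> ?B"
    have "\<exists>y. \<exists>\<delta>>0. x \<in> approx_points g m d y \<eta> \<delta>" if \<eta>: "0 < \<eta>" for \<eta>
    proof -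
      obtain j :: nat where j: "1 / Suc j < \<eta>" using nat_approx_posE[OF \<eta>] by auto
      obtain y and k :: nat where "x \<in> approx_points g m d y (1 / real (Suc j)) (1 / real (Suc k))"
        using x by (simp only: INT_iff UN_iff) blast
      then have "x \<in> approx_points g m d y \<eta> (1 / real (Suc k))"
        by (rule approx_points_mono) (use j in auto)
      then show ?thesis by (intro exI[of _ y] exI[of _ "1 / real (Suc k)"]) simp
    qed
    then obtain y where "has_direction_derivative g m x d y"
      by (rule direction_derivative_exists[OF assms])
    then show "x \<in> {x. \<exists>y. has_direction_derivative g m x d y}" by blast
  qed
  moreover have "?B \<in> sets borel"
    using countable_rat
    by (intro sets.countable_INT sets.countable_UN'' sets.countable_UN) (auto intro: borel_closed closed_approx_points)
  ultimately show ?thesis by simp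
qed

text \<open>The set itself is Borel, being a countable union of differences of Borel sets, so it suffices to see
  that it meets lines in direction \<open>\<xi> n\<close> in null sets.\<close>

lemma null_cover_no_line_derivative:
  assumes "0 \<le> m" "differentiable_on_lines g"
  shows "null_cover \<xi> {x. (\<exists>\<delta>>0. x \<in> lipschitz_points g m \<delta>) \<and> \<not> (\<exists>y. has_direction_derivative g m x (\<xi> n) y)}"
    (is "null_cover \<xi> ?N")
proof -
  let ?L = "\<lambda>k::nat. lipschitz_points g m (1 / real (Suc k))"
  let ?B = "\<lambda>k::nat. ?L k - {x. \<exists>y. has_direction_derivative g m x (\<xi> n) y}"
  have "null_cover \<xi> (?B k)" for k
  proof (rule null_cover_borel)
    show "?B k \<in> sets borel"
      unfolding lipschitz_points_def
      by (intro sets.Diff borel_closed closed_approx_points direction_derivative_borel assms(1))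
  next
    fix x
    let ?Q = "\<lambda>v. \<Union>j::nat. {s. x + s *\<^sub>R \<xi> n \<in> porous_points v (1 / real (Suc j)) (?L k)}"
    have "negligible (?Q (a *\<^sub>R \<xi> n))" for a
      by (rule negligible_countable_Union) (auto intro: porous_line_negligible)
    from this[of 1] this[of "- 1"] have neg: "negligible (?Q (\<xi> n))" "negligible (?Q (- \<xi> n))" by simp_all
    have N: "negligible ({t. \<not> (\<lambda>s. g (x + s *\<^sub>R \<xi> n)) differentiable (at t)} \<union> ?Q (\<xi> n) \<union> ?Q (- \<xi> n))"
      using assms(2) neg unfolding differentiable_on_lines_def by (intro negligible_Un) blast+
    show "negligible {t. x + t *\<^sub>R \<xi> n \<in> ?B k}"
    proof (rule negligible_subset[OF N], intro subsetI, rule ccontr)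
      fix t assume t: "t \<in> {t. x + t *\<^sub>R \<xi> n \<in> ?B k}"
        and nt: "t \<notin> {t. \<not> (\<lambda>s. g (x + s *\<^sub>R \<xi> n)) differentiable (at t)} \<union> ?Q (\<xi> n) \<union> ?Q (- \<xi> n)"
      from nt have "(\<lambda>s. g (x + s *\<^sub>R \<xi> n)) differentiable (at t)" by simp
      then obtain D where "((\<lambda>s. g (x + s *\<^sub>R \<xi> n)) has_real_derivative D) (at (0 + t))"
        by (auto simp: real_differentiable_def)
      then have "((\<lambda>s. g (x + (s + t) *\<^sub>R \<xi> n)) has_real_derivative D) (at 0)"
        by (simp only: DERIV_shift)
      then have "(\<lambda>s. g (x + t *\<^sub>R \<xi> n + s *\<^sub>R \<xi> n)) differentiable (at 0)"
        by (auto simp: real_differentiable_def algebra_simps)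
      then have "\<exists>y. has_direction_derivative g m (x + t *\<^sub>R \<xi> n) (\<xi> n) y"
        using t nt by (intro line_derivative_imp_direction_derivative[OF assms(1), of "1 / real (Suc k)"]) auto
      with t show False by simp
    qed
  qed
  then have "null_cover \<xi> (\<Union>k. ?B k)" by (rule null_cover_UN_nat)
  moreover have "?N \<subseteq> (\<Union>k. ?B k)"
  proof
    fix x assume "x \<in> ?N"
    then obtain \<delta> where \<delta>: "0 < \<delta>" "x \<in> lipschitz_points g m \<delta>" and n: "\<not> (\<exists>y. has_direction_derivative g m x (\<xi> n) y)" by blast
    obtain k :: nat where "1 / Suc k < \<delta>" using nat_approx_posE[OF \<delta>(1)] by auto
    then have "x \<in> ?L k"
      using approx_points_mono[OF \<delta>(2)[unfolded lipschitz_points_def], of m 0 0 "1 / real (Suc k)"]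
      unfolding lipschitz_points_def by simp
    with n show "x \<in> (\<Union>k. ?B k)" by blast
  qed
  ultimately show ?thesis using null_cover_subset by blast
qed

definition rational_combination :: "(nat \<Rightarrow> 'a::real_vector) \<Rightarrow> (nat \<times> rat) list \<Rightarrow> 'a"
  where "rational_combination \<xi> l = (\<Sum>p\<leftarrow>l. real_of_rat (snd p) *\<^sub>R \<xi> (fst p))"

lemma rational_combination_simps [simp]:
  "rational_combination \<xi> [] = 0"
  "rational_combination \<xi> (p # l) = real_of_rat (snd p) *\<^sub>R \<xi> (fst p) + rational_combination \<xi> l"
  by (simp_all add: rational_combination_def)

lemma rational_combinations_dense:
  assumes "closure (span (range \<xi>)) = (UNIV :: 'a::real_normed_vector set)"
  shows "closure (range (rational_combination \<xi>)) = UNIV"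
proof -
  let ?D = "range (rational_combination \<xi>)"
  have "x \<in> closure ?D" if "x \<in> span (range \<xi>)" for x
    using that
  proof (induction rule: span_induct_alt)
    case base
    have "rational_combination \<xi> [] \<in> ?D" by (rule rangeI)
    then show ?case using closure_subset[of ?D] by auto
  next
    case (step c v y)
    then obtain n where v: "v = \<xi> n" by blast
    obtain f where f: "\<And>k::nat. f k \<in> ?D" "f \<longlonglongrightarrow> y"
      using step.IH unfolding closure_sequential by blast
    have "c \<in> closure \<rat>" by (simp add: Rats_closure_real)
    then obtain q where q: "\<And>k::nat. q k \<in> \<rat>" "q \<longlonglongrightarrow> c"
      unfolding closure_sequential by blast
    have "q k *\<^sub>R \<xi> n + f k \<in> ?D" for k
    proof -
      obtain r where r: "q k = real_of_rat r" using q(1)[of k] by (auto elim: Rats_cases)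
      obtain l where l: "f k = rational_combination \<xi> l" using f(1)[of k] by blast
      have "q k *\<^sub>R \<xi> n + f k = rational_combination \<xi> ((n, r) # l)" by (simp add: r l)
      then show ?thesis by (simp only: rangeI)
    qed
    moreover have "(\<lambda>k. q k *\<^sub>R \<xi> n + f k) \<longlonglongrightarrow> c *\<^sub>R v + y"
      unfolding v by (intro tendsto_intros q f)
    ultimately show ?case unfolding closure_sequential by (intro exI[of _ "\<lambda>k. q k *\<^sub>R \<xi> n + f k"]) simp
  qed
  then have "closure (span (range \<xi>)) \<subseteq> closure ?D" by (intro closure_minimal) auto
  with assms show ?thesis by auto
qed

text \<open>Outside the exceptional sets there are derivatives along every \<open>\<xi> n\<close>, and derivatives add up. So there
  are derivatives along all rational combinations of the \<open>\<xi> n\<close>, and these are dense.\<close>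

theorem null_cover_lipschitz_not_robust:
  fixes g :: "'a::real_normed_vector \<Rightarrow> real"
  assumes dense: "closure (span (range \<xi>)) = UNIV" and m: "0 \<le> m" and "differentiable_on_lines g"
  shows "null_cover \<xi> {x. (\<exists>\<delta>>0. x \<in> lipschitz_points g m \<delta>) \<and> \<not> (\<exists>L. robust_derivative g m L x)}"
    (is "null_cover \<xi> ?N")
proof -
  let ?D = "range (rational_combination \<xi>)"
  define N1 where "N1 n = {x. (\<exists>\<delta>>0. x \<in> lipschitz_points g m \<delta>) \<and> \<not> (\<exists>y. has_direction_derivative g m x (\<xi> n) y)}" for n
  define N2 where "N2 u v = {x. \<exists>y z. has_direction_derivative g m x u y \<and> has_direction_derivative g m x v z \<and>
    \<not> has_direction_derivative g m x (u + v) (y + z)}" for u v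
  have "null_cover \<xi> ((\<Union>n. N1 n) \<union> (\<Union>u\<in>?D. \<Union>v\<in>?D. N2 u v))"
    unfolding N1_def N2_def
    by (intro null_cover_Un null_cover_UN_nat null_cover_UN null_cover_not_additive
        null_cover_no_line_derivative assms countable_image) simp_all
  moreover have "?N \<subseteq> (\<Union>n. N1 n) \<union> (\<Union>u\<in>?D. \<Union>v\<in>?D. N2 u v)"
  proof (intro subsetI, rule ccontr)
    fix x assume "x \<in> ?N" and nx: "x \<notin> (\<Union>n. N1 n) \<union> (\<Union>u\<in>?D. \<Union>v\<in>?D. N2 u v)"
    then obtain \<delta> where \<delta>: "0 < \<delta>" "x \<in> lipschitz_points g m \<delta>" by blast
    have base: "\<exists>y. has_direction_derivative g m x (\<xi> n) y" for n
      using nx \<delta> unfolding N1_def by blast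
    have add: "has_direction_derivative g m x (u + v) (y + z)"
      if "u \<in> ?D" "v \<in> ?D" "has_direction_derivative g m x u y" "has_direction_derivative g m x v z" for u v y z
      using nx that unfolding N2_def by blast
    have ex: "\<exists>y. has_direction_derivative g m x (rational_combination \<xi> l) y" for l
    proof (induction l)
      case Nil
      obtain y where "has_direction_derivative g m x (\<xi> 0) y" using base by blast
      from direction_derivative_scale[OF this, of 0] show ?case by auto
    next
      case (Cons p l)
      obtain y where "has_direction_derivative g m x (\<xi> (fst p)) y" using base by blast
      then have "has_direction_derivative g m x (rational_combination \<xi> [p]) (real_of_rat (snd p) * y)"
        using direction_derivative_scale by auto
      moreover obtain z where "has_direction_derivative g m x (rational_combination \<xi> l) z" using Cons.IH by blast
      ultimately have "has_direction_derivative g m x (rational_combination \<xi> [p] + rational_combination \<xi> l) (real_of_rat (snd p) * y + z)"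
        by (intro add rangeI)
      then show ?case by auto
    qed
    have "\<exists>L. robust_derivative g m L x"
    proof (rule robust_derivativeI[OF m rational_combinations_dense[OF dense]])
      fix u v and \<eta> :: real assume uv: "u \<in> ?D" "v \<in> ?D" and "0 < \<eta>"
      obtain y z where "has_direction_derivative g m x u y" "has_direction_derivative g m x v z"
        using ex uv by blast
      moreover from add[OF uv this] have "has_direction_derivative g m x (u + v) (y + z)" .
      ultimately obtain d1 d2 d3 where d: "0 < d1" "x \<in> approx_points g m u y \<eta> d1" "0 < d2" "x \<in> approx_points g m v z \<eta> d2"
        "0 < d3" "x \<in> approx_points g m (u + v) (y + z) \<eta> d3"
        using \<open>0 < \<eta>\<close> unfolding has_direction_derivative_def by meson
      let ?d = "min d1 (min d2 d3)"
      have "x \<in> additive_approx g m u v y z \<eta> ?d"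
        unfolding additive_approx_def
        using approx_points_mono[OF d(2), of m y \<eta> ?d] approx_points_mono[OF d(4), of m z \<eta> ?d]
          approx_points_mono[OF d(6), of m "y + z" \<eta> ?d] by simp
      then show "\<exists>y z. \<exists>\<delta>>0. x \<in> additive_approx g m u v y z \<eta> \<delta>"
        using d by (intro exI[of _ y] exI[of _ z] exI[of _ ?d]) simp
    qed
    with \<open>x \<in> ?N\<close> show False by blast
  qed
  ultimately show ?thesis using null_cover_subset by blast
qed

section \<open>Lipschitz points of quasiconvex functions\<close>

lemma quasiconvexD:
  assumes "quasiconvex g" "0 \<le> l" "l \<le> 1"
  shows "g (l *\<^sub>R x + (1 - l) *\<^sub>R y) \<le> max (g x) (g y)"
  using assms unfolding quasiconvex_def by simp

lemma quasiconvex_convex_sublevel: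
  assumes "quasiconvex g" shows "convex {x. g x \<le> c}"
proof (rule convexI)
  fix x y and u v :: real assume xy: "x \<in> {x. g x \<le> c}" "y \<in> {x. g x \<le> c}" and uv: "0 \<le> u" "0 \<le> v" "u + v = 1"
  have "v = 1 - u" "u \<le> 1" using uv by auto
  then show "u *\<^sub>R x + v *\<^sub>R y \<in> {x. g x \<le> c}"
    using quasiconvexD[OF assms uv(1), of x y] xy by auto
qed

lemma quasiconvex_differentiable_on_lines:
  assumes "quasiconvex g" shows "differentiable_on_lines g"
  unfolding differentiable_on_lines_def
proof (intro allI)
  fix x v
  have "quasiconvex (\<lambda>s. g (x + s *\<^sub>R v))"
    unfolding quasiconvex_def
  proof (intro allI ballI)
    fix s t l :: real assume "l \<in> {0..1}"
    then have "g (l *\<^sub>R (x + s *\<^sub>R v) + (1 - l) *\<^sub>R (x + t *\<^sub>R v)) \<le> max (g (x + s *\<^sub>R v)) (g (x + t *\<^sub>R v))"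
      by (intro quasiconvexD[OF assms]) auto
    moreover have "l *\<^sub>R (x + s *\<^sub>R v) + (1 - l) *\<^sub>R (x + t *\<^sub>R v) = x + (l *\<^sub>R s + (1 - l) *\<^sub>R t) *\<^sub>R v"
      by (simp add: algebra_simps)
    ultimately show "g (x + (l *\<^sub>R s + (1 - l) *\<^sub>R t) *\<^sub>R v) \<le> max (g (x + s *\<^sub>R v)) (g (x + t *\<^sub>R v))"
      by simp
  qed
  then show "negligible {t. \<not> (\<lambda>s. g (x + s *\<^sub>R v)) differentiable (at t)}"
    by (rule quasiconvex_real_differentiable_ae)
qed

text \<open>Monotonicity for short steps down from points of \<open>U\<close>, along the cone generated by the ball of radius
  \<open>\<rho>\<close> about \<open>e\<close>; the lower end of a step may lie outside \<open>U\<close>.\<close>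

definition cone_monotone :: "('a::real_normed_vector \<Rightarrow> real) \<Rightarrow> 'a set \<Rightarrow> 'a \<Rightarrow> real \<Rightarrow> bool"
  where "cone_monotone g U e \<rho> \<longleftrightarrow>
    (\<forall>w\<in>U. \<forall>s h. 0 \<le> s \<longrightarrow> s \<le> 1 \<longrightarrow> norm h \<le> s * \<rho> \<longrightarrow> g (w - s *\<^sub>R e + h) \<le> g w)"

lemma cone_monotoneD:
  assumes "cone_monotone g U e \<rho>" "w \<in> U" "0 \<le> s" "s \<le> 1" "norm h \<le> s * \<rho>"
  shows "g (w - s *\<^sub>R e + h) \<le> g w"
  using assms unfolding cone_monotone_def by blast

text \<open>The point \<open>w - s e + h\<close> lies on the segment from \<open>w\<close> to a point of the ball of minima.\<close>

lemma cone_monotone_if_minimal_on_ball: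
  assumes "quasiconvex g" "0 < r" and min: "\<And>x y. y \<in> ball z r \<Longrightarrow> g y \<le> g x"
  shows "cone_monotone g (ball (z + e) (r / 2)) e (r / 2)"
  unfolding cone_monotone_def
proof (intro ballI allI impI)
  fix w h :: 'a and s :: real assume w: "w \<in> ball (z + e) (r / 2)" and s: "0 \<le> s" "s \<le> 1" and h: "norm h \<le> s * (r / 2)"
  show "g (w - s *\<^sub>R e + h) \<le> g w"
  proof (cases "s = 0")
    case True
    then show ?thesis using h by simp
  next
    case False
    define y where "y = w - e + (1 / s) *\<^sub>R h"
    have "norm ((w - (z + e)) + (1 / s) *\<^sub>R h) \<le> norm (w - (z + e)) + norm ((1 / s) *\<^sub>R h)"
      by (rule norm_triangle_ineq)
    also have "norm (w - (z + e)) < r / 2" using w by (simp add: dist_norm norm_minus_commute)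
    also have "norm ((1 / s) *\<^sub>R h) \<le> r / 2"
      using h s False by (simp add: pos_divide_le_eq mult.commute)
    finally have "norm (y - z) < r" unfolding y_def by (simp add: algebra_simps)
    then have "y \<in> ball z r" by (simp add: dist_norm norm_minus_commute)
    moreover have "s *\<^sub>R y + (1 - s) *\<^sub>R w = w - s *\<^sub>R e + h"
      unfolding y_def using False by (simp add: algebra_simps)
    ultimately show ?thesis using quasiconvexD[OF assms(1) s, of y w] min[of y w] by simp
  qed
qed

text \<open>A single index serves as slope and as reciprocal scale, which makes the sets increasing in \<open>m\<close>.\<close>

definition line_lipschitz_points :: "('a::real_normed_vector \<Rightarrow> real) \<Rightarrow> 'a \<Rightarrow> nat \<Rightarrow> 'a set"
  where "line_lipschitz_points g v m = {y. \<forall>s. \<bar>s\<bar> < 1 / real (Suc m) \<longrightarrow> g (y + s *\<^sub>R v) \<le> g y + real m * \<bar>s\<bar>}"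

lemma line_lipschitz_points_mono:
  assumes "m \<le> n" shows "line_lipschitz_points g v m \<subseteq> line_lipschitz_points g v n"
proof
  fix y assume y: "y \<in> line_lipschitz_points g v m"
  show "y \<in> line_lipschitz_points g v n"
    unfolding line_lipschitz_points_def
  proof (intro CollectI allI impI)
    fix s :: real assume "\<bar>s\<bar> < 1 / real (Suc n)"
    also have "1 / real (Suc n) \<le> 1 / real (Suc m)" using assms by (intro divide_left_mono) auto
    finally have "g (y + s *\<^sub>R v) \<le> g y + real m * \<bar>s\<bar>" using y unfolding line_lipschitz_points_def by blast
    also have "\<dots> \<le> g y + real n * \<bar>s\<bar>" using assms by (simp add: mult_right_mono)
    finally show "g (y + s *\<^sub>R v) \<le> g y + real n * \<bar>s\<bar>" .
  qed
qed

lemma line_lipschitz_if_differentiable: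
  assumes "(\<lambda>s. g (x + s *\<^sub>R v)) differentiable (at t)"
  shows "\<exists>m. x + t *\<^sub>R v \<in> line_lipschitz_points g v m"
proof -
  obtain D where "((\<lambda>s. g (x + s *\<^sub>R v)) has_real_derivative D) (at t)"
    using assms by (auto simp: real_differentiable_def)
  then have lim: "(\<lambda>h. (g (x + (t + h) *\<^sub>R v) - g (x + t *\<^sub>R v)) / h) \<midarrow>0\<rightarrow> D" by (simp add: DERIV_def)
  obtain \<delta> where \<delta>: "0 < \<delta>" "\<And>h. h \<noteq> 0 \<Longrightarrow> \<bar>h\<bar> < \<delta> \<Longrightarrow> \<bar>(g (x + (t + h) *\<^sub>R v) - g (x + t *\<^sub>R v)) / h - D\<bar> < 1"
    using tendstoD[OF lim, of 1] by (auto simp: eventually_at dist_real_def)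
  obtain k :: nat where k: "1 / Suc k < \<delta>" using nat_approx_posE[OF \<delta>(1)] by auto
  obtain j :: nat where j: "\<bar>D\<bar> + 1 \<le> j" using real_arch_simple by blast
  define m where "m = max k j"
  have "x + t *\<^sub>R v \<in> line_lipschitz_points g v m"
    unfolding line_lipschitz_points_def
  proof (intro CollectI allI impI)
    fix s :: real assume s: "\<bar>s\<bar> < 1 / real (Suc m)"
    show "g (x + t *\<^sub>R v + s *\<^sub>R v) \<le> g (x + t *\<^sub>R v) + real m * \<bar>s\<bar>"
    proof (cases "s = 0")
      case False
      have "1 / real (Suc m) \<le> 1 / real (Suc k)" unfolding m_def by (intro divide_left_mono) auto
      then have "\<bar>(g (x + (t + s) *\<^sub>R v) - g (x + t *\<^sub>R v)) / s - D\<bar> < 1" using \<delta>(2)[OF False] s k by linarith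
      then have "\<bar>(g (x + (t + s) *\<^sub>R v) - g (x + t *\<^sub>R v)) / s\<bar> \<le> real m" using j unfolding m_def by linarith
      then have "\<bar>g (x + (t + s) *\<^sub>R v) - g (x + t *\<^sub>R v)\<bar> \<le> real m * \<bar>s\<bar>"
        using False by (simp add: abs_divide pos_divide_le_eq)
      then show ?thesis by (simp add: scaleR_add_left add.assoc)
    qed simp
  qed
  then show ?thesis by blast
qed

lemma null_cover_not_line_lipschitz:
  assumes "differentiable_on_lines g"
  shows "null_cover \<xi> (- (\<Union>m. closure (line_lipschitz_points g (\<xi> n) m)))" (is "null_cover \<xi> (- ?C)")
proof (rule null_cover_borel)
  show "- ?C \<in> sets borel" by (intro borel_comp sets.countable_UN) auto
next
  fix x
  show "negligible {t. x + t *\<^sub>R \<xi> n \<in> - ?C}"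
  proof (rule negligible_subset)
    show "negligible {t. \<not> (\<lambda>s. g (x + s *\<^sub>R \<xi> n)) differentiable (at t)}"
      using assms unfolding differentiable_on_lines_def by blast
    show "{t. x + t *\<^sub>R \<xi> n \<in> - ?C} \<subseteq> {t. \<not> (\<lambda>s. g (x + s *\<^sub>R \<xi> n)) differentiable (at t)}"
      using line_lipschitz_if_differentiable[of g x "\<xi> n"] closure_subset by blast
  qed
qed

text \<open>Upper Lipschitz points, with \<open>g x\<close> replaced by \<open>g (x + s e)\<close> for small \<open>s\<close>. The shift makes the
  condition insensitive to a jump of \<open>g\<close> at \<open>x\<close>, and it can be verified at limits of line Lipschitz points.\<close>

definition upper_points :: "('a::real_normed_vector \<Rightarrow> real) \<Rightarrow> 'a set \<Rightarrow> 'a \<Rightarrow> real \<Rightarrow> nat \<Rightarrow> 'a set"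
  where "upper_points g U e \<rho> k = {x\<in>U. \<forall>\<tau> s h. 0 < \<tau> \<longrightarrow> \<tau> < 1 / real (Suc k) \<longrightarrow> 0 < s \<longrightarrow> s < 1 / real (Suc k) \<longrightarrow>
    norm h \<le> \<tau> * \<rho> / 2 \<longrightarrow> g (x + h) \<le> g (x + s *\<^sub>R e) + real k * \<tau>}"

lemma rational_combination_nth:
  "rational_combination \<xi> l = (\<Sum>i<length l. real_of_rat (snd (l ! i)) *\<^sub>R \<xi> (fst (l ! i)))"
  unfolding rational_combination_def by (simp add: sum_list_sum_nth atLeast0LessThan)

text \<open>By the Lipschitz bounds along the lines, \<open>g\<close> exceeds \<open>g (x + s e)\<close> by at most a multiple of \<open>\<tau>\<close> at points
  near \<open>x + N \<tau> q \<xi> n\<close>, for each of the \<open>N\<close> terms \<open>q \<xi> n\<close> of \<open>e\<close>. Their average is close to \<open>x + \<tau> e\<close>, so by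
  quasiconvexity the same bound holds there; and \<open>x + \<tau> e\<close> dominates all points \<open>x + h\<close> with \<open>norm h\<close> at
  most \<open>\<tau> * \<rho> / 2\<close>.\<close>

lemma upper_points_cover:
  assumes qc: "quasiconvex g" and cm: "cone_monotone g U e \<rho>" and "open U" "0 < \<rho>" "x \<in> U"
    and e: "e = rational_combination \<xi> l" "l \<noteq> []"
    and cl: "\<And>n. x \<in> (\<Union>m. closure (line_lipschitz_points g (\<xi> n) m))"
  shows "\<exists>k. x \<in> upper_points g U e \<rho> k"
proof -
  define N where "N = length l"
  define n where "n i = fst (l ! i)" for i
  define q where "q i = real_of_rat (snd (l ! i))" for i
  have e_sum: "e = (\<Sum>i<N. q i *\<^sub>R \<xi> (n i))" unfolding e rational_combination_nth N_def n_def q_def ..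
  have N: "0 < real N" using e(2) unfolding N_def by simp
  obtain M where M: "\<And>n. x \<in> closure (line_lipschitz_points g (\<xi> n) (M n))"
  proof -
    have "\<forall>n. \<exists>m. x \<in> closure (line_lipschitz_points g (\<xi> n) m)" using cl by simp
    from choice[OF this] show thesis using that by blast
  qed
  \<comment> \<open>A common index for the finitely many directions that occur in \<open>e\<close>.\<close>
  define m where "m = (\<Sum>i<N. M (n i))"
  have xcl: "x \<in> closure (line_lipschitz_points g (\<xi> (n i)) m)" if "i < N" for i
  proof -
    have "M (n i) \<le> m" unfolding m_def using that by (intro member_le_sum) auto
    then show ?thesis using M closure_mono[OF line_lipschitz_points_mono] by blast
  qed
  define S where "S = 1 + (\<Sum>i<N. \<bar>q i\<bar>)"
  have qS: "\<bar>q i\<bar> \<le> S" if "i < N" for i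
    using member_le_sum[of i "{..<N}" "\<lambda>i. \<bar>q i\<bar>"] that unfolding S_def by simp
  have S: "0 < S" unfolding S_def by (intro add_pos_nonneg sum_nonneg) auto
  obtain u where u: "0 < u" "ball x u \<subseteq> U" using assms(3,5) by (meson open_contains_ball)
  define B where "B = norm e + \<rho>"
  have B: "0 < B" unfolding B_def using assms(4) by (intro add_nonneg_pos) auto
  define \<epsilon> where "\<epsilon> = min 1 (min (u / B) (1 / (real (Suc m) * real N * S)))"
  have "0 < \<epsilon>" unfolding \<epsilon>_def using u(1) B N S by simp
  obtain k1 :: nat where k1: "1 / Suc k1 < \<epsilon>" using nat_approx_posE[OF \<open>0 < \<epsilon>\<close>] by auto
  obtain k2 :: nat where k2: "real m * real N * S \<le> k2" using real_arch_simple by blast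
  define k where "k = max k1 k2"
  have "1 / real (Suc k) \<le> 1 / real (Suc k1)" unfolding k_def by (intro divide_left_mono) auto
  with k1 have k\<epsilon>: "1 / real (Suc k) < \<epsilon>" by linarith
  have km: "real m * real N * S \<le> real k" using k2 unfolding k_def by linarith
  have "x \<in> upper_points g U e \<rho> k"
    unfolding upper_points_def
  proof (intro CollectI conjI allI impI \<open>x \<in> U\<close>)
    fix \<tau> s :: real and h :: 'a assume \<tau>: "0 < \<tau>" "\<tau> < 1 / real (Suc k)" and s: "0 < s" "s < 1 / real (Suc k)"
      and h: "norm h \<le> \<tau> * \<rho> / 2"
    have \<tau>\<epsilon>: "\<tau> < \<epsilon>" "s < \<epsilon>" using \<tau>(2) s(2) k\<epsilon> by linarith+
    have near: "x + v \<in> U" if "norm v \<le> t * B" "0 < t" "t < \<epsilon>" for v t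
    proof -
      have "t < u / B" using that(3) unfolding \<epsilon>_def by simp
      then have "t * B < u" using B by (simp add: pos_less_divide_eq)
      then have "x + v \<in> ball x u" using that(1) by (simp add: dist_norm)
      with u(2) show ?thesis by blast
    qed
    \<comment> \<open>Points this close to \<open>x\<close> are dominated by \<open>x + s e\<close>, and their average stays within \<open>\<tau> * \<rho> / 2\<close> of \<open>x\<close>.\<close>
    define \<kappa> where "\<kappa> = min (s * \<rho>) (\<tau> * \<rho> / 2)"
    have "0 < \<kappa>" unfolding \<kappa>_def using s \<tau> assms(4) by simp
    have "\<exists>y. y \<in> line_lipschitz_points g (\<xi> (n i)) m \<and> norm (y - x) < \<kappa>" if "i < N" for i
      using xcl[OF that] \<open>0 < \<kappa>\<close> unfolding closure_approachable by (auto simp: dist_norm)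
    then obtain y where y: "\<And>i. i < N \<Longrightarrow> y i \<in> line_lipschitz_points g (\<xi> (n i)) m" "\<And>i. i < N \<Longrightarrow> norm (y i - x) < \<kappa>"
      by metis
    define c where "c = g (x + s *\<^sub>R e) + real k * \<tau>"
    define p where "p i = y i + (real N * \<tau> * q i) *\<^sub>R \<xi> (n i)" for i
    have gp: "g (p i) \<le> c" if i: "i < N" for i
    proof -
      have "x + s *\<^sub>R e \<in> U"
        using s \<tau>\<epsilon> assms(4) by (intro near[of _ s]) (auto simp: B_def)
      then have "g (x + s *\<^sub>R e - s *\<^sub>R e + (y i - x)) \<le> g (x + s *\<^sub>R e)"
        using y(2)[OF i] s \<tau>\<epsilon> unfolding \<kappa>_def \<epsilon>_def by (intro cone_monotoneD[OF cm]) auto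
      then have gy: "g (y i) \<le> g (x + s *\<^sub>R e)" by simp
      have abs: "\<bar>real N * \<tau> * q i\<bar> \<le> real N * S * \<tau>"
        using qS[OF i] N \<tau>(1) by (simp add: abs_mult)
      have "\<tau> < 1 / (real (Suc m) * real N * S)" using \<tau>\<epsilon> unfolding \<epsilon>_def by simp
      then have "real N * S * \<tau> < 1 / real (Suc m)"
        using N S by (simp add: pos_less_divide_eq mult_ac del: of_nat_Suc)
      then have "g (p i) \<le> g (y i) + real m * \<bar>real N * \<tau> * q i\<bar>"
        using y(1)[OF i] abs unfolding p_def line_lipschitz_points_def by auto
      also have "real m * \<bar>real N * \<tau> * q i\<bar> \<le> real m * (real N * S * \<tau>)"
        using abs by (intro mult_left_mono) auto
      also have "\<dots> = (real m * real N * S) * \<tau>" by simp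
      also have "\<dots> \<le> real k * \<tau>" using km \<tau>(1) by (intro mult_right_mono) auto
      finally show ?thesis using gy unfolding c_def by simp
    qed
    define w where "w = (\<Sum>i<N. (1 / real N) *\<^sub>R p i)"
    have "w \<in> {x. g x \<le> c}"
      unfolding w_def using gp N
      by (intro convex_sum quasiconvex_convex_sublevel[OF qc]) auto
    then have gw: "g w \<le> c" by simp
    define K where "K = (\<Sum>i<N. (1 / real N) *\<^sub>R (y i - x))"
    have "(1 / real N) *\<^sub>R p i = (1 / real N) *\<^sub>R (y i - x) + (1 / real N) *\<^sub>R x + \<tau> *\<^sub>R q i *\<^sub>R \<xi> (n i)" for i
      unfolding p_def using N by (simp add: algebra_simps)
    then have "w = K + real N *\<^sub>R (1 / real N) *\<^sub>R x + \<tau> *\<^sub>R e"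
      unfolding w_def K_def e_sum by (simp add: sum.distrib scaleR_sum_right sum_constant_scaleR)
    then have w: "w = x + (\<tau> *\<^sub>R e + K)" using N by simp
    have "norm K \<le> (\<Sum>i<N. (1 / real N) * \<kappa>)"
      unfolding K_def using y(2) N by (intro sum_norm_le) (auto simp: divide_right_mono less_imp_le)
    also have "\<dots> = \<kappa>" using N by simp
    finally have K: "norm K \<le> \<tau> * \<rho> / 2" unfolding \<kappa>_def by simp
    have "norm (\<tau> *\<^sub>R e + K) \<le> \<tau> * norm e + \<tau> * \<rho> / 2"
      using norm_triangle_ineq[of "\<tau> *\<^sub>R e" K] K \<tau>(1) by simp
    also have "\<dots> \<le> \<tau> * B" unfolding B_def using \<tau>(1) assms(4) by (simp add: algebra_simps)
    finally have "w \<in> U" unfolding w using \<tau>(1) \<tau>\<epsilon>(1) by (rule near)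
    moreover have "norm (h - K) \<le> \<tau> * \<rho>" using norm_triangle_ineq4[of h K] h K by simp
    ultimately have "g (w - \<tau> *\<^sub>R e + (h - K)) \<le> g w"
      using \<tau> \<tau>\<epsilon> unfolding \<epsilon>_def by (intro cone_monotoneD[OF cm]) auto
    moreover have "w - \<tau> *\<^sub>R e + (h - K) = x + h" unfolding w by simp
    ultimately show "g (x + h) \<le> g (x + s *\<^sub>R e) + real k * \<tau>" using gw unfolding c_def by simp
  qed
  then show ?thesis by blast
qed

text \<open>Close to \<open>x - t e\<close> there is a point \<open>a\<close> that satisfies the same upper bound as \<open>x\<close>. The bound at \<open>a\<close> covers
  a neighbourhood of \<open>x\<close> of size comparable to \<open>t\<close>, and \<open>a + (t / 4) e\<close> is dominated by every point of
  such a neighbourhood. So the oscillation of \<open>g\<close> near \<open>x\<close> is at most a multiple of \<open>t\<close>.\<close>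

lemma lipschitz_if_upper_not_porous:
  assumes cm: "cone_monotone g U e \<rho>" and "open U" "0 < \<rho>"
    and x: "x \<in> upper_points g U e \<rho> k" and np: "x \<notin> porous_points (- e) (\<rho> / 4) (upper_points g U e \<rho> k)"
  shows "\<exists>m::nat. \<exists>\<delta>>0. x \<in> lipschitz_points g (real m) \<delta>"
proof -
  have "x \<in> U" using x unfolding upper_points_def by simp
  then obtain u where u: "0 < u" "ball x u \<subseteq> U" using assms(2) by (meson open_contains_ball)
  obtain \<delta>0 where \<delta>0: "0 < \<delta>0" "\<And>t. 0 < t \<Longrightarrow> t < \<delta>0 \<Longrightarrow> \<exists>a\<in>upper_points g U e \<rho> k. norm (a - (x + t *\<^sub>R - e)) < \<rho> / 4 * t"
    using not_porousE[OF x np] by blast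
  define B where "B = norm e + \<rho>"
  have B: "0 < B" unfolding B_def using assms(3) by (intro add_nonneg_pos) auto
  define \<delta>1 where "\<delta>1 = Min {\<delta>0, 1, 4 * u / \<rho>, 1 / real (Suc k), \<rho> / (2 * B * real (Suc k))}"
  have \<delta>1: "0 < \<delta>1" "\<delta>1 \<le> \<delta>0" "\<delta>1 \<le> 1" "\<delta>1 \<le> 4 * u / \<rho>" "\<delta>1 \<le> 1 / real (Suc k)" "\<delta>1 \<le> \<rho> / (2 * B * real (Suc k))"
    unfolding \<delta>1_def using \<delta>0(1) u(1) B assms(3) by auto
  have main: "g (x + h) \<le> g (x + h') + real k * (2 * B / \<rho>) * t"
    if t: "0 < t" "t < \<delta>1" and h: "norm h \<le> \<rho> / 4 * t" and h': "norm h' \<le> \<rho> / 4 * t" for t h h'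
  proof -
    obtain a where a: "a \<in> upper_points g U e \<rho> k" "norm (a - (x - t *\<^sub>R e)) < \<rho> / 4 * t"
      using \<delta>0(2)[of t] t \<delta>1(2) by auto
    define b where "b = a - (x - t *\<^sub>R e)"
    have b: "norm b < \<rho> / 4 * t" "a = x - t *\<^sub>R e + b" using a(2) unfolding b_def by auto
    \<comment> \<open>Chosen so that \<open>\<tau> * \<rho> / 2 = t * B\<close> bounds the distance from \<open>a\<close> to \<open>x + h\<close>.\<close>
    define \<tau> where "\<tau> = 2 * B / \<rho> * t"
    have "0 < \<tau>" unfolding \<tau>_def using B assms(3) t(1) by simp
    have "t < \<rho> / (2 * B * real (Suc k))" using t(2) \<delta>1(6) by linarith
    then have "t * (2 * B * real (Suc k)) < \<rho>" using B by (simp add: pos_less_divide_eq)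
    then have "\<tau> < 1 / real (Suc k)" unfolding \<tau>_def using assms(3) B t(1) by (simp add: field_simps)
    have "norm (t *\<^sub>R e + (h - b)) \<le> t * norm e + (norm h + norm b)"
      using norm_triangle_ineq[of "t *\<^sub>R e" "h - b"] norm_triangle_ineq4[of h b] t(1) by simp
    also have "\<dots> \<le> t * norm e + \<rho> * t" using h b(1) mult_pos_pos[OF assms(3) t(1)] by (simp add: mult.commute)
    also have "\<dots> = \<tau> * \<rho> / 2" unfolding \<tau>_def B_def using assms(3) by (simp add: field_simps)
    finally have "norm (t *\<^sub>R e + (h - b)) \<le> \<tau> * \<rho> / 2" .
    then have "g (a + (t *\<^sub>R e + (h - b))) \<le> g (a + (t / 4) *\<^sub>R e) + real k * \<tau>"
      using a(1) \<open>0 < \<tau>\<close> \<open>\<tau> < 1 / real (Suc k)\<close> t \<delta>1(5) unfolding upper_points_def by simp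
    moreover have "a + (t *\<^sub>R e + (h - b)) = x + h" unfolding b(2) by simp
    moreover have "g (a + (t / 4) *\<^sub>R e) \<le> g (x + h')"
    proof -
      have "t < 4 * u / \<rho>" using t(2) \<delta>1(4) by linarith
      then have "\<rho> / 4 * t < u" using assms(3) by (simp add: field_simps)
      then have "x + h' \<in> ball x u" using h' by (simp add: dist_norm)
      then have "x + h' \<in> U" using u(2) by blast
      moreover have "norm (b - h') \<le> 3 * t / 4 * \<rho>"
        using norm_triangle_ineq4[of b h'] b(1) h' mult_pos_pos[OF t(1) assms(3)] by (simp add: mult.commute)
      ultimately have "g (x + h' - (3 * t / 4) *\<^sub>R e + (b - h')) \<le> g (x + h')"
        using t \<delta>1(3) by (intro cone_monotoneD[OF cm]) auto
      moreover have "x + h' - (3 * t / 4) *\<^sub>R e + (b - h') = a + (t / 4) *\<^sub>R e"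
      proof -
        have "t *\<^sub>R e = (3 * t / 4) *\<^sub>R e + (t / 4) *\<^sub>R e" by (simp add: scaleR_add_left[symmetric])
        then show ?thesis unfolding b(2) by simp
      qed
      ultimately show ?thesis by simp
    qed
    ultimately show ?thesis unfolding \<tau>_def by (simp add: mult.assoc)
  qed
  define m0 where "m0 = real k * (2 * B / \<rho>) * (4 / \<rho>)"
  obtain m :: nat where m: "m0 \<le> m" using real_arch_simple by blast
  have "x \<in> lipschitz_points g (real m) (\<rho> / 4 * \<delta>1)"
  proof (subst lipschitz_points_iff, goal_cases)
    case 1
    show ?case using assms(3) \<delta>1(1) by simp
  next
    case 2
    show ?case
    proof (intro allI impI)
      fix h :: 'a assume h: "norm h < \<rho> / 4 * \<delta>1"
      show "\<bar>g (x + h) - g x\<bar> \<le> real m * norm h"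
      proof (cases "h = 0")
        case False
        define t where "t = 4 / \<rho> * norm h"
        have t: "0 < t" "t < \<delta>1" "norm h \<le> \<rho> / 4 * t" "norm (0::'a) \<le> \<rho> / 4 * t"
          unfolding t_def using False h assms(3) by (auto simp: field_simps)
        have "\<bar>g (x + h) - g (x + 0)\<bar> \<le> real k * (2 * B / \<rho>) * t"
          using main[OF t(1-4)] main[OF t(1,2,4,3)] by linarith
        also have "\<dots> = m0 * norm h" unfolding m0_def t_def by simp
        also have "\<dots> \<le> real m * norm h" using m by (intro mult_right_mono) auto
        finally show ?thesis by simp
      qed simp
    qed
  qed
  then show ?thesis using assms(3) \<delta>1(1) by (intro exI[of _ m] exI[of _ "\<rho> / 4 * \<delta>1"]) simp
qed

text \<open>Cone monotonicity is available near \<open>z + e\<close>, and \<open>e\<close> should be a combination of the \<open>\<xi> n\<close>. As the rational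
  combinations are dense, countably many choices of \<open>e\<close> serve all points.\<close>

theorem null_cover_not_lipschitz:
  fixes g :: "'a::real_normed_vector \<Rightarrow> real"
  assumes "closure (span (range \<xi>)) = UNIV" "quasiconvex g" "0 < r" "\<And>x y. y \<in> ball z r \<Longrightarrow> g y \<le> g x"
  shows "null_cover \<xi> {x. \<not> (\<exists>m::nat. \<exists>\<delta>>0. x \<in> lipschitz_points g (real m) \<delta>)}" (is "null_cover \<xi> ?N")
proof -
  \<comment> \<open>The term \<open>(0, 0)\<close> does not change the value but makes the list nonempty, as averaging over it requires.\<close>
  define e where "e l = rational_combination \<xi> ((0, 0) # l)" for l
  define U where "U l = ball (z + e l) (r / 2)" for l
  let ?Q = "\<lambda>l. upper_points g (U l) (e l) (r / 2)"
  let ?Z = "(\<Union>n. - (\<Union>m. closure (line_lipschitz_points g (\<xi> n) m))) \<union>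
    (\<Union>l\<in>UNIV. \<Union>k. porous_points (- e l) (r / 2 / 4) (?Q l k))"
  have "null_cover \<xi> ?Z"
    using assms(3)
    by (intro null_cover_Un null_cover_UN_nat null_cover_UN null_cover_porous[OF assms(1)]
        null_cover_not_line_lipschitz quasiconvex_differentiable_on_lines[OF assms(2)]) simp_all
  moreover have "?N \<subseteq> ?Z"
  proof (intro subsetI, rule ccontr)
    fix x assume "x \<in> ?N" "x \<notin> ?Z"
    have "x - z \<in> closure (range (rational_combination \<xi>))" using rational_combinations_dense[OF assms(1)] by simp
    then obtain l where "dist (rational_combination \<xi> l) (x - z) < r / 2"
      unfolding closure_approachable using assms(3) by (metis half_gt_zero imageE)
    then have "x \<in> U l" unfolding U_def e_def by (simp add: dist_norm norm_minus_commute algebra_simps)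
    have cm: "cone_monotone g (U l) (e l) (r / 2)"
      unfolding U_def by (rule cone_monotone_if_minimal_on_ball) (use assms in auto)
    have "open (U l)" unfolding U_def by simp
    obtain k where k: "x \<in> ?Q l k"
      using upper_points_cover[OF assms(2) cm \<open>open (U l)\<close> _ \<open>x \<in> U l\<close> e_def[of l]] assms(3) \<open>x \<notin> ?Z\<close> by auto
    have "x \<notin> porous_points (- e l) (r / 2 / 4) (?Q l k)" using \<open>x \<notin> ?Z\<close> by blast
    then have "\<exists>m::nat. \<exists>\<delta>>0. x \<in> lipschitz_points g (real m) \<delta>"
      using assms(3) by (intro lipschitz_if_upper_not_porous[OF cm \<open>open (U l)\<close> _ k]) simp_all
    with \<open>x \<in> ?N\<close> show False by blast
  qed
  ultimately show ?thesis using null_cover_subset by blast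
qed

theorem null_cover_not_robust:
  fixes g :: "'a::real_normed_vector \<Rightarrow> real"
  assumes "closure (span (range \<xi>)) = UNIV" "quasiconvex g" "0 < r" "\<And>x y. y \<in> ball z r \<Longrightarrow> g y \<le> g x"
  shows "null_cover \<xi> {x. \<not> (\<exists>m::nat. \<exists>L. robust_derivative g (real m) L x)}" (is "null_cover \<xi> ?N")
proof -
  let ?Z = "{x. \<not> (\<exists>m::nat. \<exists>\<delta>>0. x \<in> lipschitz_points g (real m) \<delta>)} \<union>
    (\<Union>m::nat. {x. (\<exists>\<delta>>0. x \<in> lipschitz_points g (real m) \<delta>) \<and> \<not> (\<exists>L. robust_derivative g (real m) L x)})"
  have "null_cover \<xi> ?Z"
    by (intro null_cover_Un null_cover_UN_nat null_cover_lipschitz_not_robust null_cover_not_lipschitz[OF assms(1-3)]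
        quasiconvex_differentiable_on_lines assms(1,2)) (use assms(4) in auto)
  moreover have "?N \<subseteq> ?Z" by blast
  ultimately show ?thesis by (rule null_cover_subset)
qed

section \<open>Reduction to truncations\<close>

lemma quasiconvex_max_const:
  assumes "quasiconvex f" shows "quasiconvex (\<lambda>x. max (f x) c)"
  unfolding quasiconvex_def
proof (intro allI ballI)
  fix x y and l :: real assume "l \<in> {0..1}"
  then have "f (l *\<^sub>R x + (1 - l) *\<^sub>R y) \<le> max (f x) (f y)" by (intro quasiconvexD[OF assms]) auto
  then show "max (f (l *\<^sub>R x + (1 - l) *\<^sub>R y)) c \<le> max (max (f x) c) (max (f y) c)" by linarith
qed

text \<open>The sublevel set at \<open>c - 1\<close> is of second category, so it is dense in some open set, which contains a
  point of continuity; there the value is at most \<open>c - 1\<close>.\<close>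

lemma sublevel_contains_ball:
  fixes f :: "'a::real_normed_vector \<Rightarrow> real"
  assumes "densely_continuous f" "top_ess_inf f = -\<infinity>"
  obtains z r where "0 < r" "\<And>y. y \<in> ball z r \<Longrightarrow> f y < c"
proof -
  have "\<not> first_category {x. f x < c - 1}"
  proof
    assume "first_category {x. f x < c - 1}"
    then have "ereal (c - 1) \<le> top_ess_inf f" unfolding top_ess_inf_def by (intro Sup_upper) blast
    with assms(2) show False by simp
  qed
  then have "\<not> nowhere_dense {x. f x < c - 1}"
    unfolding first_category_def by (auto dest: spec[of _ "{{x. f x < c - 1}}"])
  then have ne: "interior (closure {x. f x < c - 1}) \<noteq> {}" unfolding nowhere_dense_def .
  obtain D where D: "closure D = UNIV" "\<And>x. x \<in> D \<Longrightarrow> isCont f x"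
    using assms(1) unfolding densely_continuous_def by blast
  have "D \<inter> interior (closure {x. f x < c - 1}) \<noteq> {}"
    using open_Int_closure_eq_empty[of "interior (closure {x. f x < c - 1})" D] ne D(1) by auto
  then obtain z where z: "z \<in> D" "z \<in> closure {x. f x < c - 1}" using interior_subset by blast
  obtain s where s: "\<And>n::nat. f (s n) < c - 1" "s \<longlonglongrightarrow> z" using z(2) unfolding closure_sequential by auto
  have "(\<lambda>n. f (s n)) \<longlonglongrightarrow> f z" using isCont_tendsto_compose[OF D(2)[OF z(1)] s(2)] .
  then have "f z \<le> c - 1" by (rule LIMSEQ_le_const2) (use s(1) less_imp_le in blast)
  then have "f z < c" by simp
  have "(f \<longlongrightarrow> f z) (nhds z)" using D(2)[OF z(1)] by (simp add: isCont_def tendsto_nhds_iff)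
  from order_tendstoD(2)[OF this \<open>f z < c\<close>] obtain r where "0 < r" "\<And>y. dist y z < r \<Longrightarrow> f y < c"
    unfolding eventually_nhds_metric by blast
  then show thesis using that[of r z] by (simp add: dist_commute)
qed

lemma has_direction_derivative_local:
  assumes "has_direction_derivative g m x d y" "0 < \<epsilon>" and eq: "\<And>h. norm h < \<epsilon> \<Longrightarrow> f (x + h) = g (x + h)"
  shows "has_direction_derivative f m x d y"
  unfolding has_direction_derivative_def
proof (intro allI impI)
  fix \<eta> :: real assume "0 < \<eta>"
  then obtain \<delta> where \<delta>: "0 < \<delta>" "x \<in> approx_points g m d y \<eta> \<delta>"
    using assms(1) unfolding has_direction_derivative_def by blast
  define N where "N = 1 + norm d"
  have N: "0 < N" "0 \<le> norm d" unfolding N_def by (auto intro: add_pos_nonneg)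
  define r where "r = min \<delta> (\<epsilon> / (2 * N))"
  have "x \<in> approx_points f m d y \<eta> r"
    unfolding approx_points_def
  proof (intro CollectI allI impI)
    fix t :: real and h :: 'a assume t: "\<bar>t\<bar> < r" and h: "norm h < r"
    have "r * (2 * N) \<le> \<epsilon>" unfolding r_def using N assms(2) by (simp add: min_mult_distrib_right del: distrib_left_numeral)
    have "norm (t *\<^sub>R d + h) \<le> \<bar>t\<bar> * norm d + norm h" using norm_triangle_ineq[of "t *\<^sub>R d" h] by simp
    also have "\<dots> < r * norm d + r" using t h N(2) by (intro add_le_less_mono mult_right_mono) auto
    also have "\<dots> = r * N" unfolding N_def by (simp add: algebra_simps)
    also have "\<dots> \<le> \<epsilon>" using \<open>r * (2 * N) \<le> \<epsilon>\<close> assms(2) by linarith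
    finally have "f (x + (t *\<^sub>R d + h)) = g (x + (t *\<^sub>R d + h))" by (rule eq)
    moreover have "f x = g x" using eq[of 0] assms(2) by simp
    moreover have "\<bar>g (x + t *\<^sub>R d + h) - g x - t * y\<bar> \<le> \<eta> * \<bar>t\<bar> + m * norm h"
      using t h unfolding r_def by (intro approx_pointsD[OF \<delta>(2)]) auto
    ultimately show "\<bar>f (x + t *\<^sub>R d + h) - f x - t * y\<bar> \<le> \<eta> * \<bar>t\<bar> + m * norm h" by (simp add: add.assoc)
  qed
  moreover have "0 < r" unfolding r_def using \<delta>(1) assms(2) N by simp
  ultimately show "\<exists>\<delta>>0. x \<in> approx_points f m d y \<eta> \<delta>" by blast
qed

text \<open>A robust derivative entails continuity, so the truncation exceeds \<open>c\<close>, and agrees with \<open>f\<close>, in a whole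
  neighbourhood of \<open>x\<close>.\<close>

lemma robust_derivative_of_truncation:
  assumes "robust_derivative (\<lambda>x. max (f x) c) m L x" "c < f x" "0 \<le> m"
  shows "robust_derivative f m L x"
proof -
  let ?g = "\<lambda>x. max (f x) c"
  have L: "bounded_linear L" "\<And>d. has_direction_derivative ?g m x d (L d)"
    using assms(1) unfolding robust_derivative_def by auto
  obtain \<delta> where \<delta>: "0 < \<delta>" "x \<in> approx_points ?g m 0 (L 0) 1 \<delta>"
    using L(2)[of 0] unfolding has_direction_derivative_def by (meson zero_less_one)
  define \<epsilon> where "\<epsilon> = min \<delta> ((f x - c) / (1 + m))"
  have \<epsilon>: "0 < \<epsilon>" unfolding \<epsilon>_def using \<delta>(1) assms(2,3) by simp
  have "f (x + h) = ?g (x + h)" if "norm h < \<epsilon>" for h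
  proof -
    have lip: "\<bar>?g (x + h) - ?g x\<bar> \<le> m * norm h"
      using that unfolding \<epsilon>_def by (intro approx_points_lipschitz[OF \<delta>(2)]) simp
    have "norm h < (f x - c) / (1 + m)" using that unfolding \<epsilon>_def by simp
    then have "norm h * (1 + m) < f x - c" using assms(3) by (simp add: pos_less_divide_eq)
    then have "m * norm h < f x - c" 
      using norm_ge_zero[of h] unfolding distrib_left mult.commute[of _ m] by linarith
    with lip assms(2) have "c < ?g (x + h)" by (simp add: max_def split: if_splits)
    then show ?thesis by (simp add: max_def split: if_splits)
  qed
  then have "has_direction_derivative f m x d (L d)" for d
    using has_direction_derivative_local[OF L(2) \<epsilon>] by blast
  with L(1) show ?thesis unfolding robust_derivative_def by blast
qed

theorem corollary4p3:
  fixes f :: "'a::banach \<Rightarrow> real"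
  assumes "separable_space (euclidean :: 'a topology)"
    and "quasiconvex f"
    and "densely_continuous f"
    and "top_ess_inf f = -\<infinity>"
  shows "\<exists>N. aronszajn_null N \<and> (\<forall>x\<in>UNIV - N. hadamard_differentiable_at f x)"
proof -
  obtain D :: "'a set" where D: "countable D" "closure D = UNIV"
    using assms(1) unfolding separable_space_def by (auto simp: euclidean_closure_of)
  \<comment> \<open>Each truncation is minimal on a ball and, at a point \<open>x\<close> of continuity with \<open>- k < f x\<close>, agrees with \<open>f\<close> nearby.\<close>
  define g where "g k x = max (f x) (- real k)" for k x
  define N where "N k = {x. \<not> (\<exists>m::nat. \<exists>L. robust_derivative (g k) (real m) L x)}" for k
  have "N k \<in> sets borel" for k
  proof -
    have "N k = - (\<Union>m::nat. {x. \<exists>L. robust_derivative (g k) (real m) L x})" unfolding N_def by auto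
    moreover have "(\<Union>m::nat. {x. \<exists>L. robust_derivative (g k) (real m) L x}) \<in> sets borel"
      by (intro sets.countable_UN) (auto intro: robust_points_borel[OF D])
    ultimately show ?thesis using borel_comp by metis
  qed
  moreover have "null_cover \<xi> (N k)" if \<xi>: "closure (span (range \<xi>)) = UNIV" for k and \<xi> :: "nat \<Rightarrow> 'a"
  proof -
    obtain z r where "0 < r" "\<And>y. y \<in> ball z r \<Longrightarrow> f y < - real k"
      using sublevel_contains_ball[OF assms(3,4)] by metis
    then show ?thesis unfolding N_def
      by (intro null_cover_not_robust[OF \<xi>, where z = z and r = r])
        (auto simp: g_def[abs_def] intro!: quasiconvex_max_const[OF assms(2)])
  qed
  ultimately have "aronszajn_null (\<Union>k. N k)"
    by (intro aronszajn_nullI sets.countable_UN null_cover_UN_nat) auto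
  moreover have "hadamard_differentiable_at f x" if "x \<notin> (\<Union>k. N k)" for x
  proof -
    obtain k :: nat where k: "- f x < real k" using reals_Archimedean2 by blast
    obtain m :: nat and L where "robust_derivative (g k) (real m) L x" using \<open>x \<notin> (\<Union>k. N k)\<close> unfolding N_def by blast
    then have "robust_derivative f (real m) L x"
      unfolding g_def[abs_def] using k by (intro robust_derivative_of_truncation[of f "- real k"]) auto
    then show ?thesis by (rule robust_derivative_hadamard) simp
  qed
  ultimately show ?thesis by blast
qed

end
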